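(* Let $d\ge2$ be an integer, $\nu=d/2-1$, $\ell\in\{0,1,2,\dots\}$, $\mu=\ell+\nu$, $R>0$ and $\alpha>0$. Let $$\Delta_{\ell}(k;\alpha)=\Bigl(\alpha+\frac{\ell}{R}\Bigr)J_{\mu}(kR)-kJ_{\mu+1}(kR),$$ and let $k_{\ell,p}(\alpha)$, $p=1,2,\dots$, denote the positive roots in $k$ of $\Delta_\ell(k;\alpha)=0$, in increasing order. Then: 1. (Discreteness and reality.) For each fixed $\ell$, the roots $k_{\ell,p}(\alpha)$, $p=1,2,\dots$, are positive, real, form an increasing sequence with $k_{\ell,p}(\alpha)\to+\infty$ as $p\to\infty$, and each corresponding radial eigenfunction is unique up to a constant multiple. 2. (Analyticity.) The characteristic determinant $\Delta_\ell(k;\alpha)$ is real-analytic in $(k,\alpha)\in(0,+\infty)^2$. Consequently, each branch $k_{\ell,p}(\alpha)$ is real-analytic in $\alpha$. 3. (Strict monotonicity.) For each fixed $\ell$ and $p$, $k_{\ell,p}(\alpha)$ is strictly monotonically increasing in $\alpha\in(0,+\infty)$. 4. (Interpolation and bounds.) As $\alpha\to0^+$, $$k_{\ell,p}(\alpha)\to\frac{\mu'_{\ell,p}}{R},$$ where, for $\ell\ge1$, $\mu'_{\ell,p}$ is the $p$-th positive root of $\ell J_\mu(x)-xJ_{\mu+1}(x)=0$ (equivalently $J_\mu'(x)=\frac{\nu}{x}J_\mu(x)$), and, for $\ell=0$, $\mu'_{0,1}=0$ and $\mu'_{0,p}$ for $p\ge2$ is the $(p-1)$-th positive root of the same equation.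 As $\alpha\to+\infty$, $$k_{\ell,p}(\alpha)\to\frac{\mu_{\ell,p}}{R},$$ where $\mu_{\ell,p}$ is the $p$-th positive zero of $J_\mu(x)$. Moreover, $$\frac{\mu'_{\ell,p}}{R}<k_{\ell,p}(\alpha)<\frac{\mu_{\ell,p}}{R}\qquad\text{for all }\alpha\in(0,+\infty).$$
   Context: $J_\mu$ is the Bessel function of the first kind of order $\mu$. The numbers $k_{\ell,p}(\alpha)$ are the resonant wavenumbers of the ball $B_R(0)\subset\mathbb{R}^d$ with Robin condition $\partial_n u+\alpha u=0$. The radial eigenfunction corresponding to the root $k=k_{\ell,p}(\alpha)$ is a nontrivial solution $u$ of the radial problem with $\lambda=k^2$: $$u''+\frac{d-1}{r}u'+\Bigl(\lambda-\frac{\ell(\ell+d-2)}{r^2}\Bigr)u=0\ \ (0<r<R),\qquad |u(0)|<+\infty,\qquad u'(R)+\alpha u(R)=0.$$ *)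

theory Defs
  imports "HOL-Analysis.Analysis"
begin

(* The power series of J_mu, for real order and argument x > 0.
   The values at x <= 0 carry no meaning, since there powr is not the intended power. *)
definition bessel_J :: "real \<Rightarrow> real \<Rightarrow> real" where
  "bessel_J \<mu> x =
     (\<Sum>m. (-1) ^ m / (fact m * Gamma (\<mu> + real m + 1)) * (x / 2) powr (2 * real m + \<mu>))"

definition robin_det :: "nat \<Rightarrow> real \<Rightarrow> real \<Rightarrow> real \<Rightarrow> real \<Rightarrow> real" where
  "robin_det l \<mu> R k \<alpha> =
     (\<alpha> + real l / R) * bessel_J \<mu> (k * R) - k * bessel_J (\<mu> + 1) (k * R)"

(* Counted from 1. As card of an infinite set is 0, the conditions p >= 1 and card = p
   force only finitely many roots to lie in (0, x]. *)
definition is_pos_root :: "(real \<Rightarrow> real) \<Rightarrow> nat \<Rightarrow> real \<Rightarrow> bool" where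
  "is_pos_root f p x \<longleftrightarrow>
     1 \<le> p \<and> 0 < x \<and> f x = 0 \<and> card {y. 0 < y \<and> y \<le> x \<and> f y = 0} = p"

definition pos_root :: "(real \<Rightarrow> real) \<Rightarrow> nat \<Rightarrow> real" where
  "pos_root f p = (THE x. is_pos_root f p x)"

definition robin_root :: "nat \<Rightarrow> real \<Rightarrow> real \<Rightarrow> nat \<Rightarrow> real \<Rightarrow> real" where
  "robin_root l \<mu> R p \<alpha> = pos_root (\<lambda>k. robin_det l \<mu> R k \<alpha>) p"

definition neumann_fun :: "nat \<Rightarrow> real \<Rightarrow> real \<Rightarrow> real" where
  "neumann_fun l \<mu> x = real l * bessel_J \<mu> x - x * bessel_J (\<mu> + 1) x"

definition neumann_root :: "nat \<Rightarrow> real \<Rightarrow> nat \<Rightarrow> real" where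
  "neumann_root l \<mu> p =
     (if l = 0 then (if p = 1 then 0 else pos_root (neumann_fun l \<mu>) (p - 1))
      else pos_root (neumann_fun l \<mu>) p)"

definition dirichlet_root :: "real \<Rightarrow> nat \<Rightarrow> real" where
  "dirichlet_root \<mu> p = pos_root (bessel_J \<mu>) p"

(* u' and u'' are the first and second derivatives of u on (0, R); u' R is the one-sided
   derivative at R. The regularity condition |u(0)| < oo is read as boundedness of u near 0. *)
definition radial_eigenfunction ::
    "nat \<Rightarrow> nat \<Rightarrow> real \<Rightarrow> real \<Rightarrow> real \<Rightarrow> (real \<Rightarrow> real) \<Rightarrow> bool" where
  "radial_eigenfunction d l R \<alpha> lam u \<longleftrightarrow>
     (\<exists>u' u''.
        (\<forall>r\<in>{0<..R}. (u has_real_derivative u' r) (at r within {0<..R})) \<and>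
        (\<forall>r\<in>{0<..<R}. (u' has_real_derivative u'' r) (at r)) \<and>
        (\<forall>r\<in>{0<..<R}.
           u'' r + (real d - 1) / r * u' r
             + (lam - real l * (real l + real d - 2) / r\<^sup>2) * u r = 0) \<and>
        Bfun u (at_right 0) \<and>
        u' R + \<alpha> * u R = 0) \<and>
     (\<exists>r\<in>{0<..R}. u r \<noteq> 0)"

definition real_analytic_on :: "(real \<Rightarrow> real) \<Rightarrow> real set \<Rightarrow> bool" where
  "real_analytic_on f S \<longleftrightarrow>
     (\<forall>a\<in>S. \<exists>c. \<exists>e>0. \<forall>x. \<bar>x - a\<bar> < e \<longrightarrow> (\<lambda>n. c n * (x - a) ^ n) sums f x)"

definition real_analytic2_on :: "(real \<times> real \<Rightarrow> real) \<Rightarrow> (real \<times> real) set \<Rightarrow> bool" where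
  "real_analytic2_on f S \<longleftrightarrow>
     (\<forall>(a, b)\<in>S. \<exists>c. \<exists>e>0. \<forall>x y. \<bar>x - a\<bar> < e \<and> \<bar>y - b\<bar> < e \<longrightarrow>
        ((\<lambda>(i, j). c i j * (x - a) ^ i * (y - b) ^ j) has_sum f (x, y)) (UNIV :: (nat \<times> nat) set))"

end

theory Submission
  imports Defs "HOL-Complex_Analysis.Complex_Analysis"
begin

text \<open>
Write \<open>J\<^sub>\<mu>(x) = (x/2)\<^sup>\<mu> E(z)\<close> with \<open>z = (x/2)\<^sup>2\<close> and \<open>E\<close> entire. For \<open>x = k R\<close> the Robin condition becomes
\<open>h(z) = \<alpha> R + l\<close>, where \<open>h = - 2 z E' / E\<close>; the Neumann roots belong to \<open>\<alpha> = 0\<close> and the Dirichlet roots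
are the poles of \<open>h\<close>. Now \<open>h' = 2 Q / E\<^sup>2\<close> with \<open>Q = E\<^sup>2 + \<mu> E E' + z E'\<^sup>2\<close>, and \<open>Q > 0\<close> because
\<open>(z\<^bsup>\<mu>+1\<^esup> Q)' = z\<^sup>\<mu> E\<^sup>2\<close> (Lommel's integral). So \<open>h\<close> increases from \<open>-\<infinity>\<close> (from 0 on the first
interval) to \<open>\<infinity>\<close> between consecutive poles, and its inverses on these intervals are the branches; their
monotonicity, limits and bounds are immediate, and the holomorphic inverse function theorem makes them
analytic. There are infinitely many poles since otherwise the Riccati equation of \<open>h\<close> would force a blow-up.
\<close>

section \<open>The entire factor of the Bessel function\<close>

text \<open>Passing to z removes the branch point of \<open>(x / 2) powr \<mu>\<close>, so one
  definition of E over a general field serves twice: on the real line for order and intermediate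
  values, in the complex plane for isolated zeros and for the inverse function theorem.
  Differentiating E only raises its order, since E' is minus the E of order \<mu> + 1. Hence
  Bessel's equation turns into the algebraic recurrence \<open>bessel_E_rec\<close>, and every
  derivative below is simplified by that one identity. Branch n lives between zeros n and n + 1 of
  E, the origin counting as zero number 0, and it carries the root with p = n + 1. For
  \<open>l = 0\<close> the first branch reaches \<beta> = 0 only at z = 0; this is why
  \<open>neumann_root\<close> assigns the value 0 there and shifts the other indices. Uniqueness of
  the eigenfunction comes from the end R: two solutions with the same Robin condition have Wronskian
  zero. The obstacle is that u' R is only a one-sided derivative of u, so the interior Wronskian
  cannot simply be continued to R.\<close>

definition bessel_coeff :: "real \<Rightarrow> nat \<Rightarrow> real" where
  "bessel_coeff \<mu> m = (-1) ^ m / (fact m * Gamma (\<mu> + real m + 1))"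

definition bessel_E :: "real \<Rightarrow> 'a::{real_normed_field,banach} \<Rightarrow> 'a" where
  "bessel_E \<mu> z = (\<Sum>m. of_real (bessel_coeff \<mu> m) * z ^ m)"

text \<open>Each step multiplies by \<mu> + m + 1, which is at least 1. The bound lets the
  exponential series dominate the series of E.\<close>

lemma Gamma_add_nat_ge:
  assumes "0 \<le> \<mu>"
  shows "Gamma (\<mu> + 1) \<le> Gamma (\<mu> + real m + 1)"
proof (induction m)
  case (Suc m)
  have "Gamma (\<mu> + real (Suc m) + 1) = (\<mu> + real m + 1) * Gamma (\<mu> + real m + 1)"
    using Gamma_plus1[of "\<mu> + real m + 1"] nonpos_Ints_nonpos[of "\<mu> + real m + 1"] assms
    by (force simp: add_ac)
  moreover have "0 < Gamma (\<mu> + real m + 1)"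
    using assms by (intro Gamma_real_pos) auto
  ultimately have "1 * Gamma (\<mu> + real m + 1) \<le> Gamma (\<mu> + real (Suc m) + 1)"
    using assms by (auto intro!: mult_right_mono)
  then show ?case using Suc by simp
qed simp

lemma bessel_coeff_0: "bessel_coeff \<mu> 0 = 1 / Gamma (\<mu> + 1)"
  by (simp add: bessel_coeff_def)

lemma bessel_coeff_rec:
  assumes "0 \<le> \<mu>"
  shows "bessel_coeff \<mu> m = (\<mu> + 1 + real m) * bessel_coeff (\<mu> + 1) m"
proof -
  have "Gamma (\<mu> + 1 + real m + 1) = (\<mu> + real m + 1) * Gamma (\<mu> + real m + 1)"
    using Gamma_plus1[of "\<mu> + real m + 1"] nonpos_Ints_nonpos[of "\<mu> + real m + 1"] assms
    by (force simp: add_ac)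
  moreover have "0 < \<mu> + real m + 1" using assms by simp
  ultimately show ?thesis
    by (simp add: bessel_coeff_def divide_simps add_ac)
qed

text \<open>The Gamma factor sees only the sum of \<mu> and the index, so an index shift is an order
  shift. This is E' = - E of order \<mu> + 1, read off coefficientwise.\<close>

lemma bessel_coeff_Suc:
  "real (Suc m) * bessel_coeff \<mu> (Suc m) = - bessel_coeff (\<mu> + 1) m"
proof -
  have "Gamma (\<mu> + real (Suc m) + 1) = Gamma (\<mu> + 1 + real m + 1)"
    by (simp add: add_ac)
  then show ?thesis
    by (simp add: bessel_coeff_def del: of_nat_Suc)
qed

lemma summable_bessel_E:
  fixes z :: "'a::{real_normed_field,banach}"
  assumes "0 \<le> \<mu>"
  shows "summable (\<lambda>m. of_real (bessel_coeff \<mu> m) * z ^ m)"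
proof (rule summable_comparison_test')
  show "summable (\<lambda>m. 1 / Gamma (\<mu> + 1) * (inverse (fact m) * norm z ^ m))"
    by (intro summable_mult summable_exp)
  fix m :: nat
  have "0 < Gamma (\<mu> + 1)" using assms by (intro Gamma_real_pos) auto
  then show "norm (of_real (bessel_coeff \<mu> m) * z ^ m)
      \<le> 1 / Gamma (\<mu> + 1) * (inverse (fact m) * norm z ^ m)"
    using Gamma_add_nat_ge[OF assms, of m]
    by (simp add: bessel_coeff_def norm_mult norm_power abs_mult norm_divide frac_le
        mult_right_mono divide_simps mult_mono)
qed

lemma bessel_E_0 [simp]: "bessel_E \<mu> (0::'a::{real_normed_field,banach}) = of_real (1 / Gamma (\<mu> + 1))"
  by (simp add: bessel_E_def powser_zero bessel_coeff_0)

lemma bessel_E_of_real: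
  assumes "0 \<le> \<mu>"
  shows "bessel_E \<mu> (of_real x :: 'a::{real_normed_field,banach}) = of_real (bessel_E \<mu> x)"
  using summable_bessel_E[OF assms, of x]
  by (simp add: bessel_E_def suminf_of_real)

lemma DERIV_bessel_E:
  fixes z :: "'a::{real_normed_field,banach}"
  assumes "0 \<le> \<mu>"
  shows "(bessel_E \<mu> has_field_derivative - bessel_E (\<mu> + 1) z) (at z)"
proof -
  let ?c = "\<lambda>m. of_real (bessel_coeff \<mu> m) :: 'a"
  have "((\<lambda>x. \<Sum>n. ?c n * x ^ n) has_field_derivative (\<Sum>n. diffs ?c n * z ^ n)) (at z)"
    using summable_bessel_E[OF assms] by (rule termdiffs_strong_converges_everywhere)
  also have "diffs ?c = (\<lambda>n. - of_real (bessel_coeff (\<mu> + 1) n))"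
  proof
    fix n
    have "diffs ?c n = of_real (real (Suc n) * bessel_coeff \<mu> (Suc n))"
      by (simp add: diffs_def)
    then show "diffs ?c n = - of_real (bessel_coeff (\<mu> + 1) n)"
      by (simp only: bessel_coeff_Suc of_real_minus)
  qed
  also have "(\<Sum>n. - of_real (bessel_coeff (\<mu> + 1) n) * z ^ n) = - bessel_E (\<mu> + 1) z"
    unfolding bessel_E_def
    using suminf_minus[OF summable_bessel_E[of "\<mu> + 1" z]] assms by simp
  finally show ?thesis
    by (simp add: bessel_E_def[abs_def])
qed

lemmas DERIV_bessel_E' [derivative_intros] = DERIV_chain2[OF DERIV_bessel_E]

lemma continuous_on_bessel_E [continuous_intros]:
  fixes g :: "'b::topological_space \<Rightarrow> 'a::{real_normed_field,banach}"
  assumes "0 \<le> \<mu>" "continuous_on A g"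
  shows "continuous_on A (\<lambda>x. bessel_E \<mu> (g x))"
proof -
  have "continuous_on UNIV (bessel_E \<mu> :: 'a \<Rightarrow> 'a)"
    using DERIV_bessel_E[OF assms(1)] by (auto intro!: DERIV_continuous_on)
  then show ?thesis
    using assms(2) by (rule continuous_on_compose2) auto
qed

lemma holomorphic_on_bessel_E [holomorphic_intros]:
  assumes "0 \<le> \<mu>" "g holomorphic_on A"
  shows "(\<lambda>z. bessel_E \<mu> (g z)) holomorphic_on A"
proof -
  have "bessel_E \<mu> holomorphic_on UNIV"
    using DERIV_bessel_E[OF assms(1)] by (auto simp: holomorphic_on_open)
  then show ?thesis
    using holomorphic_on_compose_gen[OF assms(2), of "bessel_E \<mu>" UNIV] by (simp add: o_def)
qed

text \<open>With orders \<mu> + 1 and \<mu> + 2 read as - E' and E'', this is Bessel's equation z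
  E'' + (\<mu> + 1) E' + E = 0.\<close>

lemma bessel_E_rec:
  fixes z :: "'a::{real_normed_field,banach}"
  assumes "0 \<le> \<mu>"
  shows "z * bessel_E (\<mu> + 2) z = of_real (\<mu> + 1) * bessel_E (\<mu> + 1) z - bessel_E \<mu> z"
proof -
  let ?a = "\<lambda>m. of_real (bessel_coeff \<mu> m) * z ^ m" and ?b = "\<lambda>m. of_real (bessel_coeff (\<mu> + 1) m) * z ^ m"
  let ?g = "\<lambda>m. of_real (\<mu> + 1) * ?b m - ?a m"
  have sa: "summable ?a" and sb: "summable ?b"
    using assms by (auto intro!: summable_bessel_E)
  \<comment> \<open>The factor m kills the term of index 0, so the series may be shifted by one
    without a remainder.\<close>
  have g: "?g m = - of_real (real m * bessel_coeff (\<mu> + 1) m) * z ^ m" for m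
    by (simp add: bessel_coeff_rec[OF assms, of m] algebra_simps)
  have "?g (Suc m) = z * (of_real (bessel_coeff (\<mu> + 2) m) * z ^ m)" for m
    using g[of "Suc m"] unfolding bessel_coeff_Suc by (simp add: add_ac)
  then have "(\<Sum>m. ?g (Suc m)) = z * bessel_E (\<mu> + 2) z"
    using summable_bessel_E[of "\<mu> + 2" z] assms by (simp add: bessel_E_def suminf_mult)
  moreover have "(\<Sum>m. ?g (Suc m)) = (\<Sum>m. ?g m)"
    using suminf_split_head[of ?g] sa sb g[of 0] by (simp add: summable_diff summable_mult)
  moreover have "(\<Sum>m. ?g m) = of_real (\<mu> + 1) * bessel_E (\<mu> + 1) z - bessel_E \<mu> z"
    using suminf_diff[OF summable_mult[OF sb] sa, of "of_real (\<mu> + 1)"] suminf_mult[OF sb]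
    by (simp add: bessel_E_def)
  ultimately show ?thesis by simp
qed

lemma bessel_J_eq_bessel_E:
  assumes "0 \<le> \<mu>" "0 < x"
  shows "bessel_J \<mu> x = (x / 2) powr \<mu> * bessel_E \<mu> ((x / 2)\<^sup>2)"
proof -
  have "(-1) ^ m / (fact m * Gamma (\<mu> + real m + 1)) * (x / 2) powr (2 * real m + \<mu>)
      = (x / 2) powr \<mu> * (of_real (bessel_coeff \<mu> m) * ((x / 2)\<^sup>2) ^ m)" for m
  proof -
    have "(x / 2) powr (2 * real m + \<mu>) = (x / 2) powr \<mu> * ((x / 2)\<^sup>2) ^ m"
      using assms powr_realpow[of "x/2" "2 * m"] by (simp add: powr_add power_mult)
    then show ?thesis by (simp add: bessel_coeff_def)
  qed
  then show ?thesis
    using summable_bessel_E[OF assms(1), of "(x/2)\<^sup>2"]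
    unfolding bessel_J_def bessel_E_def by (simp only: suminf_mult)
qed

section \<open>The logarithmic derivative\<close>

text \<open>The Q of the overview, with E' replaced by minus the E of order \<mu> + 1.\<close>

definition bessel_Q :: "real \<Rightarrow> 'a::{real_normed_field,banach} \<Rightarrow> 'a" where
  "bessel_Q \<mu> z = (bessel_E \<mu> z)\<^sup>2 - of_real \<mu> * bessel_E \<mu> z * bessel_E (\<mu> + 1) z + z * (bessel_E (\<mu> + 1) z)\<^sup>2"

lemma DERIV_powr_bessel_Q:
  assumes "0 \<le> \<mu>" "0 < z"
  shows "((\<lambda>z. z powr (\<mu> + 1) * bessel_Q \<mu> z) has_real_derivative z powr \<mu> * (bessel_E \<mu> z)\<^sup>2) (at z)"
proof -
  let ?e = "bessel_E \<mu> z" and ?f = "bessel_E (\<mu> + 1) z" and ?g = "bessel_E (\<mu> + 2) z"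
  have g: "z * ?g = (\<mu> + 1) * ?f - ?e"
    using bessel_E_rec[OF assms(1), of z] by simp
  have p: "z powr (\<mu> + 1) = z * z powr \<mu>"
    using assms by (simp add: powr_add)
  have "((\<lambda>z. z powr (\<mu> + 1) * bessel_Q \<mu> z) has_real_derivative
      (\<mu> + 1) * z powr \<mu> * bessel_Q \<mu> z
      + z powr (\<mu> + 1) * (- 2 * ?e * ?f + \<mu> * ?f\<^sup>2 + \<mu> * ?e * ?g + ?f\<^sup>2 - 2 * z * ?f * ?g)) (at z)"
    unfolding bessel_Q_def using assms
    by (auto intro!: derivative_eq_intros simp: power2_eq_square algebra_simps)
  \<comment> \<open>The factor z is distributed so that \<open>?g\<close> occurs only in the product
    \<open>z * ?g\<close>, which the recurrence then replaces.\<close>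
  also have "(\<mu> + 1) * z powr \<mu> * bessel_Q \<mu> z
      + z powr (\<mu> + 1) * (- 2 * ?e * ?f + \<mu> * ?f\<^sup>2 + \<mu> * ?e * ?g + ?f\<^sup>2 - 2 * z * ?f * ?g)
      = z powr \<mu> * ((\<mu> + 1) * bessel_Q \<mu> z - 2 * z * ?e * ?f + z * \<mu> * ?f\<^sup>2 + \<mu> * ?e * (z * ?g)
          + z * ?f\<^sup>2 - 2 * z * ?f * (z * ?g))"
    unfolding p by (simp add: algebra_simps)
  also have "\<dots> = z powr \<mu> * ?e\<^sup>2"
    unfolding g bessel_Q_def by (simp add: power2_eq_square algebra_simps)
  finally show ?thesis .
qed

text \<open>Monotonicity of z^(\<mu>+1) Q from its value 0 at the origin would give only a weak
  inequality. Strictness comes from Q(0) > 0: by continuity Q is positive at some x in (0, z), and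
  the monotone product carries this from x to z.\<close>

lemma bessel_Q_pos:
  assumes "0 \<le> \<mu>" "0 < (z::real)"
  shows "0 < bessel_Q \<mu> z"
proof -
  define c where "c = Gamma (\<mu> + 1)"
  have "0 < c" unfolding c_def using assms by (intro Gamma_real_pos) auto
  have "Gamma (\<mu> + 1 + 1) = (\<mu> + 1) * c"
    unfolding c_def using Gamma_plus1[of "\<mu> + 1"] nonpos_Ints_nonpos[of "\<mu> + 1"] assms by force
  then have "bessel_Q \<mu> (0::real) = (1 / c)\<^sup>2 - \<mu> * (1 / c) * (1 / ((\<mu> + 1) * c))"
    by (simp add: bessel_Q_def c_def)
  also have "\<dots> = (1 / c)\<^sup>2 / (\<mu> + 1)"
  proof -
    have "1 + \<mu> \<noteq> 0" "c \<noteq> 0" using assms \<open>0 < c\<close> by auto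
    then show ?thesis by (simp add: divide_simps power2_eq_square)
  qed
  also have "\<dots> > 0" using \<open>0 < c\<close> assms by simp
  finally have "0 < bessel_Q \<mu> (0::real)" .
  moreover have "continuous_on UNIV (bessel_Q \<mu> :: real \<Rightarrow> real)"
    unfolding bessel_Q_def[abs_def] using assms by (intro continuous_intros) auto
  then have "(bessel_Q \<mu> \<longlongrightarrow> bessel_Q \<mu> (0::real)) (at_right 0)"
    by (simp add: continuous_on_eq_continuous_at isCont_def filterlim_at_split)
  ultimately have "\<forall>\<^sub>F x in at_right (0::real). 0 < bessel_Q \<mu> x"
    by (simp add: order_tendsto_iff)
  moreover have "\<forall>\<^sub>F x in at_right 0. x \<in> {0<..<z}"
    using assms by (intro eventually_at_right_real)
  ultimately obtain x where x: "0 < bessel_Q \<mu> x" "0 < x" "x < z"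
    using eventually_happens[OF eventually_conj] trivial_limit_at_right_real by fastforce
  have "x powr (\<mu> + 1) * bessel_Q \<mu> x \<le> z powr (\<mu> + 1) * bessel_Q \<mu> z"
  proof (rule DERIV_nonneg_imp_nondecreasing[where f = "\<lambda>z. z powr (\<mu> + 1) * bessel_Q \<mu> z"])
    fix y assume "x \<le> y" "y \<le> z"
    then have "0 < y" using x by simp
    then show "\<exists>D. ((\<lambda>z. z powr (\<mu> + 1) * bessel_Q \<mu> z) has_real_derivative D) (at y) \<and> D \<ge> 0"
      using DERIV_powr_bessel_Q[OF assms(1), of y] by (metis mult_nonneg_nonneg powr_ge_zero zero_le_power2)
  qed (use x in simp)
  moreover have "0 < x powr (\<mu> + 1) * bessel_Q \<mu> x" using x by simp
  ultimately have "0 < z powr (\<mu> + 1) * bessel_Q \<mu> z" by linarith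
  then show ?thesis using assms by (simp add: zero_less_mult_iff)
qed

definition bessel_h :: "real \<Rightarrow> 'a::{real_normed_field,banach} \<Rightarrow> 'a" where
  "bessel_h \<mu> z = 2 * z * bessel_E (\<mu> + 1) z / bessel_E \<mu> z"

lemma bessel_h_of_real:
  assumes "0 \<le> \<mu>"
  shows "bessel_h \<mu> (of_real x :: 'a::{real_normed_field,banach}) = of_real (bessel_h \<mu> x)"
  using assms by (simp add: bessel_h_def bessel_E_of_real)

lemma bessel_Q_of_real:
  assumes "0 \<le> \<mu>"
  shows "bessel_Q \<mu> (of_real x :: 'a::{real_normed_field,banach}) = of_real (bessel_Q \<mu> x)"
  using assms by (simp add: bessel_Q_def bessel_E_of_real)

text \<open>Stated over a general field because the real case yields monotonicity, the complex case
  the nonzero derivative for the inverse function theorem.\<close>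

lemma DERIV_bessel_h:
  fixes z :: "'a::{real_normed_field,banach}"
  assumes "0 \<le> \<mu>" "bessel_E \<mu> z \<noteq> 0"
  shows "(bessel_h \<mu> has_field_derivative 2 * bessel_Q \<mu> z / (bessel_E \<mu> z)\<^sup>2) (at z)"
proof -
  let ?e = "bessel_E \<mu> z" and ?f = "bessel_E (\<mu> + 1) z" and ?g = "bessel_E (\<mu> + 2) z"
  have g: "z * ?g = of_real (\<mu> + 1) * ?f - ?e"
    using bessel_E_rec[OF assms(1), of z] by simp
  have "(bessel_h \<mu> has_field_derivative ((2 * ?f - 2 * (z * ?g)) * ?e + 2 * z * ?f * ?f) / (?e * ?e)) (at z)"
    unfolding bessel_h_def[abs_def] using assms
    by (auto intro!: derivative_eq_intros simp: algebra_simps)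
  also have "(2 * ?f - 2 * (z * ?g)) * ?e + 2 * z * ?f * ?f = 2 * bessel_Q \<mu> z"
    unfolding g bessel_Q_def by (simp add: power2_eq_square algebra_simps)
  finally show ?thesis by (simp add: power2_eq_square)
qed

text \<open>Without zeros beyond b, h would be smooth there, and g = h - \<mu> would solve the
  Riccati equation 2 z g' = g^2 + 4 z - \<mu>^2 for all large z.\<close>

lemma bessel_E_zero_above:
  assumes "0 \<le> \<mu>"
  shows "\<exists>z>b. bessel_E \<mu> (z::real) = 0"
proof (rule ccontr)
  assume no: "\<not> ?thesis"
  define g where "g z = bessel_h \<mu> z - \<mu>" for z
  \<comment> \<open>From \<mu>^2 / 2 on, the term \<mu>^2 / (2 z) is at most 1, so that g' keeps at
    least 1 of its constant 2.\<close>
  define Z where "Z = max (max b 0 + 1) (\<mu>\<^sup>2 / 2)"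
  have Z: "b < Z" "0 < Z" "\<mu>\<^sup>2 / 2 \<le> Z" by (auto simp: Z_def)
  define g' where "g' z = 2 - \<mu>\<^sup>2 / (2 * z) + (g z)\<^sup>2 / (2 * z)" for z
  have g': "(g has_real_derivative g' z) (at z)" "1 + (g z)\<^sup>2 / (2 * z) \<le> g' z" if "Z \<le> z" for z
  proof -
    have e: "bessel_E \<mu> z \<noteq> 0" and z: "0 < z" "\<mu>\<^sup>2 / 2 \<le> z" using no that Z by auto
    have "2 * bessel_Q \<mu> z / (bessel_E \<mu> z)\<^sup>2 = g' z"
      using e z unfolding bessel_Q_def g'_def g_def bessel_h_def
      by (simp add: field_simps power2_eq_square)
    then show "(g has_real_derivative g' z) (at z)"
      unfolding g_def[abs_def] using DERIV_bessel_h[OF assms e] by (auto intro!: derivative_eq_intros)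
    show "1 + (g z)\<^sup>2 / (2 * z) \<le> g' z"
      using z by (simp add: g'_def field_simps)
  qed
  \<comment> \<open>\<open>g = h - \<mu>\<close> grows at least linearly, so it becomes positive; then
    \<open>g' \<ge> g\<^sup>2 / (2 z)\<close> makes \<open>- 1 / g - ln z / 2\<close> increasing, which is impossible.\<close>
  have lin: "g Z - Z \<le> g z - z" if "Z \<le> z" for z
  proof (rule DERIV_nonneg_imp_nondecreasing[OF that])
    fix x assume "Z \<le> x" "x \<le> z"
    moreover from this have "0 \<le> (g x)\<^sup>2 / (2 * x)" using Z by simp
    ultimately show "\<exists>D. ((\<lambda>z. g z - z) has_real_derivative D) (at x) \<and> D \<ge> 0"
      using g'[of x] by (intro exI[of _ "g' x - 1"]) (auto intro!: derivative_eq_intros)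
  qed
  \<comment> \<open>The linear bound gives g z \<ge> g Z + (z - Z), which is at least 1 once z - Z
    \<ge> \<bar>g Z\<bar> + 1.\<close>
  define Y where "Y = Z + \<bar>g Z\<bar> + 1"
  have Y: "Z \<le> Y" "0 < g z" if "Y \<le> z" for z
  proof -
    show "Z \<le> Y" by (simp add: Y_def)
    then have "g Z - Z \<le> g z - z" using lin[of z] that by simp
    then show "0 < g z" using that abs_ge_minus_self[of "g Z"] unfolding Y_def by linarith
  qed
  have blow: "- 1 / g Y - ln Y / 2 \<le> - 1 / g z - ln z / 2" if "Y \<le> z" for z
  proof (rule DERIV_nonneg_imp_nondecreasing[OF that])
    fix x assume "Y \<le> x" "x \<le> z"
    then have x: "0 < g x" "Z \<le> x" "0 < x" using Y[of x] Z by auto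
    have "((\<lambda>z. - 1 / g z - ln z / 2) has_real_derivative g' x / (g x)\<^sup>2 - 1 / (2 * x)) (at x)"
      using x g'(1)[of x] by (auto intro!: derivative_eq_intros simp: power2_eq_square)
    moreover have "1 / (2 * x) \<le> g' x / (g x)\<^sup>2"
    proof -
      have "1 / (2 * x) * (g x)\<^sup>2 \<le> g' x" using g'(2)[of x] x by simp
      then show ?thesis using x by (simp add: pos_le_divide_eq)
    qed
    ultimately show "\<exists>D. ((\<lambda>z. - 1 / g z - ln z / 2) has_real_derivative D) (at x) \<and> D \<ge> 0"
      by (metis diff_ge_0_iff_ge)
  qed
  define C where "C = - 1 / g Y - ln Y / 2"
  \<comment> \<open>Chosen so that - ln z / 2 \<le> C; since - 1 / g z is negative, the monotone
    quantity would fall below its starting value C.\<close>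
  define z where "z = max Y (exp (- 2 * C))"
  have "- 2 * C \<le> ln z"
    unfolding z_def by (subst ln_ge_iff) (auto simp: less_max_iff_disj)
  moreover have "0 < g z" using Y[of z] by (simp add: z_def)
  then have "- 1 / g z < 0" by simp
  moreover have "C \<le> - 1 / g z - ln z / 2" using blow[of z] by (simp add: C_def z_def)
  ultimately show False by linarith
qed

text \<open>The complex E is entire and not constant, as it is nonzero at 0 and has a zero by
  \<open>bessel_E_zero_above\<close>. Hence it has finitely many zeros in a closed disc.\<close>

lemma finite_bessel_E_zeros:
  assumes "0 \<le> \<mu>"
  shows "finite {z. 0 \<le> z \<and> z \<le> b \<and> bessel_E \<mu> z = (0::real)}"
proof -
  obtain a :: real where a: "bessel_E \<mu> a = 0" using bessel_E_zero_above[OF assms] by blast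
  have "0 < Gamma (\<mu> + 1)" using assms by (intro Gamma_real_pos) auto
  then have "bessel_E \<mu> (0::complex) \<noteq> bessel_E \<mu> (of_real a)"
    by (simp add: bessel_E_of_real[OF assms] a)
  then have "\<not> (bessel_E \<mu> :: complex \<Rightarrow> complex) constant_on UNIV"
    unfolding constant_on_def by (metis UNIV_I)
  then have "finite {z \<in> cball 0 \<bar>b\<bar>. bessel_E \<mu> (z::complex) = 0}"
    using assms by (intro holomorphic_compact_finite_zeros[where S = UNIV]) (auto intro!: holomorphic_intros)
  then have "finite (complex_of_real -` {z \<in> cball 0 \<bar>b\<bar>. bessel_E \<mu> (z::complex) = 0})"
    by (rule finite_vimageI) (simp add: inj_of_real)
  then show ?thesis
    by (rule rev_finite_subset) (auto simp: bessel_E_of_real[OF assms])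
qed

section \<open>Zeros and root branches\<close>

text \<open>Every x has a least element of S above it, the minimum of a finite set; \<open>D\<close>
  iterates this successor from the sentinel a.\<close>

lemma enumerate_unbounded_discrete:
  fixes S :: "real set"
  assumes unb: "\<And>b. \<exists>z\<in>S. b < z" and fin: "\<And>b. finite {z \<in> S. z \<le> b}" and pos: "S \<subseteq> {a<..}"
  shows "\<exists>D. D 0 = a \<and> strict_mono D \<and> S = range (\<lambda>n. D (Suc n)) \<and> filterlim D at_top sequentially"
proof -
  have "\<exists>y\<in>S. x < y \<and> (\<forall>z\<in>S. x < z \<longrightarrow> y \<le> z)" for x
  proof -
    obtain c where c: "c \<in> S" "x < c" using unb by blast
    let ?T = "{z \<in> S. x < z \<and> z \<le> c}"
    have "finite ?T" using fin[of c] by (rule rev_finite_subset) auto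
    moreover have "?T \<noteq> {}" using c by auto
    ultimately have M: "Min ?T \<in> ?T" "\<And>z. z \<in> ?T \<Longrightarrow> Min ?T \<le> z"
      using Min_in[of ?T] Min_le[of ?T] by blast+
    have "Min ?T \<le> z" if "z \<in> S" "x < z" for z
      using M(1) M(2)[of z] that by (cases "z \<le> c") auto
    then show ?thesis using M(1) by blast
  qed
  then obtain s where s: "\<And>x. s x \<in> S" "\<And>x. x < s x" "\<And>x z. z \<in> S \<Longrightarrow> x < z \<Longrightarrow> s x \<le> z"
    by metis
  define D where "D = rec_nat a (\<lambda>_. s)"
  have D: "D 0 = a" "D (Suc n) = s (D n)" for n by (simp_all add: D_def)
  have mono: "strict_mono D" by (simp add: strict_mono_Suc_iff D s)
  have top: "filterlim D at_top sequentially"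
    unfolding filterlim_at_top_dense
  proof
    fix b
    have "D n \<in> insert a S" for n by (cases n) (auto simp: D s)
    then have "{n. D n \<le> b} \<subseteq> D -` insert a {z \<in> S. z \<le> b}" by auto
    moreover have "finite (D -` insert a {z \<in> S. z \<le> b})"
      using fin mono by (intro finite_vimageI) (auto intro: strict_mono_imp_inj_on)
    ultimately have "finite {n. \<not> b < D n}" by (simp add: not_less finite_subset)
    then show "\<forall>\<^sub>F n in sequentially. b < D n"
      by (simp add: cofinite_eq_sequentially[symmetric] eventually_cofinite)
  qed
  have "S = range (\<lambda>n. D (Suc n))"
  proof (intro equalityI subsetI)
    fix z assume z: "z \<in> S"
    obtain n where n: "z \<le> D n"
      using top by (auto simp: filterlim_at_top eventually_sequentially)
    \<comment> \<open>At the least index with z \<le> D m the previous value is below z, so its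
      successor cannot jump over z.\<close>
    define m where "m = (LEAST n. z \<le> D n)"
    have m: "z \<le> D m" using n unfolding m_def by (rule LeastI)
    have "m \<noteq> 0" using m pos z D(1) by (intro notI) auto
    then obtain k where k: "m = Suc k" by (cases m) auto
    then have "D k < z" using not_less_Least[of k "\<lambda>n. z \<le> D n"] by (simp add: m_def)
    then have "D (Suc k) = z" using s(3)[OF z] m k D(2)[of k] by force
    then show "z \<in> range (\<lambda>n. D (Suc n))" by auto
  qed (auto simp: D s)
  then show ?thesis using D(1) mono top by blast
qed

text \<open>Bridge from counting by \<open>card\<close> to an enumeration: s starts at 0 while roots
  are counted from 1, so \<open>s n\<close> has exactly n + 1 roots up to and including
  itself.\<close>

lemma is_pos_root_enum:
  assumes "strict_mono s" "{x. 0 < x \<and> f x = 0} = range s"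
  shows "is_pos_root f (Suc n) x \<longleftrightarrow> x = s n"
proof -
  have "card {y. 0 < y \<and> y \<le> s m \<and> f y = 0} = Suc m" for m
  proof -
    have "{y. 0 < y \<and> y \<le> s m \<and> f y = 0} = {y \<in> range s. y \<le> s m}"
      using assms(2) by auto
    also have "\<dots> = s ` {..m}" using assms(1) by (auto simp: strict_mono_less_eq)
    finally show ?thesis
      using assms(1) by (simp add: card_image strict_mono_imp_inj_on)
  qed
  moreover have "0 < x \<and> f x = 0 \<longleftrightarrow> x \<in> range s" using assms(2) by auto
  ultimately show ?thesis
    unfolding is_pos_root_def by auto
qed

lemma pos_root_enum:
  assumes "strict_mono s" "{x. 0 < x \<and> f x = 0} = range s"
  shows "pos_root f (Suc n) = s n"
  unfolding pos_root_def is_pos_root_enum[OF assms] by simp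

text \<open>A positive slope at b would make f negative just before b, and the intermediate value
  theorem would give a zero inside the interval.\<close>

lemma deriv_nonpos_at_right_zero:
  fixes f :: "real \<Rightarrow> real"
  assumes "a < b" "continuous_on {a..b} f" "(f has_real_derivative D) (at b)" "f b = 0" "0 < f a"
    and nz: "\<And>x. a < x \<Longrightarrow> x < b \<Longrightarrow> f x \<noteq> 0"
  shows "D \<le> 0"
proof (rule ccontr)
  assume "\<not> D \<le> 0"
  then obtain d where d: "0 < d" "\<And>h. 0 < h \<Longrightarrow> h < d \<Longrightarrow> f (b - h) < f b"
    using DERIV_pos_inc_left[OF assms(3)] by auto
  define h where "h = min d (b - a) / 2"
  have h: "0 < h" "h < d" "h < b - a" using d \<open>a < b\<close> by (auto simp: h_def min_def)
  have "\<exists>x\<ge>a. x \<le> b - h \<and> f x = 0"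
    using d(2)[of h] h assms by (intro IVT2') (auto intro: continuous_on_subset)
  then obtain x where "a \<le> x" "x \<le> b - h" "f x = 0" by blast
  then show False using nz[of x] h assms by (cases "x = a") auto
qed

lemma deriv_nonneg_at_left_zero:
  fixes f :: "real \<Rightarrow> real"
  assumes "a < b" "continuous_on {a..b} f" "(f has_real_derivative D) (at a)" "f a = 0" "0 < f b"
    and nz: "\<And>x. a < x \<Longrightarrow> x < b \<Longrightarrow> f x \<noteq> 0"
  shows "0 \<le> D"
proof -
  have "- D \<le> 0"
  proof (rule deriv_nonpos_at_right_zero[of "- b" "- a" "\<lambda>x. f (- x)"])
    show "continuous_on {- b..- a} (\<lambda>x. f (- x))"
      by (rule continuous_on_compose2[OF assms(2)]) (auto intro!: continuous_intros)
    show "((\<lambda>x. f (- x)) has_real_derivative - D) (at (- a))"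
      using assms(3) by (auto simp: DERIV_mirror)
  qed (use assms in auto)
  then show ?thesis by simp
qed

text \<open>A function keeps its sign between consecutive zeros, so its slopes at these two zeros
  have opposite signs.\<close>

lemma deriv_mult_nonpos_consecutive_zeros:
  fixes f :: "real \<Rightarrow> real"
  assumes "a < b" "continuous_on {a..b} f" "f a = 0" "f b = 0"
    and D: "(f has_real_derivative D) (at a)" "(f has_real_derivative D') (at b)"
    and nz: "\<And>x. a < x \<Longrightarrow> x < b \<Longrightarrow> f x \<noteq> 0"
  shows "D * D' \<le> 0"
proof -
  \<comment> \<open>The one-sided lemmas need an end with a nonzero value, which neither a nor b
    provides; any interior point would do.\<close>
  define m where "m = (a + b) / 2"
  have m: "a < m" "m < b" using \<open>a < b\<close> by (auto simp: m_def)
  then have c: "continuous_on {a..m} f" "continuous_on {m..b} f"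
    using assms(2) by (auto intro: continuous_on_subset)
  consider "0 < f m" | "0 < - f m" using nz[OF m] by linarith
  then show ?thesis
  proof cases
    case 1
    have "0 \<le> D" "D' \<le> 0"
      using deriv_nonneg_at_left_zero[OF m(1) c(1) D(1)] deriv_nonpos_at_right_zero[OF m(2) c(2) D(2)]
        1 assms m by auto
    then show ?thesis by (simp add: mult_nonneg_nonpos)
  next
    case 2
    have "0 \<le> - D" "- D' \<le> 0"
      using deriv_nonneg_at_left_zero[OF m(1) continuous_on_minus[OF c(1)] DERIV_minus[OF D(1)]]
        deriv_nonpos_at_right_zero[OF m(2) continuous_on_minus[OF c(2)] DERIV_minus[OF D(2)]]
        2 assms m by auto
    then show ?thesis by (simp add: mult_nonpos_nonneg)
  qed
qed

lemma IVT_opposite_signs: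
  fixes f :: "real \<Rightarrow> real"
  assumes "a < b" "continuous_on {a..b} f" "f a * f b < 0"
  shows "\<exists>x. a < x \<and> x < b \<and> f x = 0"
proof -
  have "\<exists>x\<ge>a. x \<le> b \<and> f x = 0"
    using assms IVT'[of f a 0 b] IVT2'[of f b 0 a] by (auto simp: mult_less_0_iff)
  then show ?thesis using assms by (metis less_irrefl mult_zero_left mult_zero_right order_le_less)
qed

text \<open>The positive zeros of \<open>E\<close> have the indices from 1 on; index 0 stands for the left end 0 of the first
  interval.\<close>

definition bessel_zero :: "real \<Rightarrow> nat \<Rightarrow> real" where
  "bessel_zero \<mu> = (SOME D. D 0 = 0 \<and> strict_mono D \<and>
     {z. 0 < z \<and> bessel_E \<mu> z = 0} = range (\<lambda>n. D (Suc n)) \<and> filterlim D at_top sequentially)"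

lemma bessel_E_0_pos: "0 \<le> \<mu> \<Longrightarrow> 0 < bessel_E \<mu> (0::real)"
  by (auto intro!: Gamma_real_pos)

lemma bessel_zero:
  assumes "0 \<le> \<mu>"
  shows "bessel_zero \<mu> 0 = 0" "strict_mono (bessel_zero \<mu>)"
    "{z. 0 < z \<and> bessel_E \<mu> z = 0} = range (\<lambda>n. bessel_zero \<mu> (Suc n))"
    "filterlim (bessel_zero \<mu>) at_top sequentially"
proof -
  let ?S = "{z. 0 < z \<and> bessel_E \<mu> z = (0::real)}"
  have "\<exists>z\<in>?S. b < z" for b
    using bessel_E_zero_above[OF assms, of "max b 0"] by auto
  moreover have "finite {z \<in> ?S. z \<le> b}" for b
    using finite_bessel_E_zeros[OF assms, of b] by (rule rev_finite_subset) auto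
  moreover have "?S \<subseteq> {0<..}" by auto
  ultimately have "\<exists>D. D 0 = 0 \<and> strict_mono D \<and> ?S = range (\<lambda>n. D (Suc n)) \<and> filterlim D at_top sequentially"
    by (rule enumerate_unbounded_discrete)
  from someI_ex[OF this] show "bessel_zero \<mu> 0 = 0" "strict_mono (bessel_zero \<mu>)"
    "{z. 0 < z \<and> bessel_E \<mu> z = 0} = range (\<lambda>n. bessel_zero \<mu> (Suc n))"
    "filterlim (bessel_zero \<mu>) at_top sequentially"
    unfolding bessel_zero_def by blast+
qed

lemma bessel_zero_nonneg: "0 \<le> \<mu> \<Longrightarrow> 0 \<le> bessel_zero \<mu> n"
  using bessel_zero(1,2)[of \<mu>] by (metis le0 strict_mono_less_eq)

lemma bessel_zero_Suc_pos: "0 \<le> \<mu> \<Longrightarrow> 0 < bessel_zero \<mu> (Suc n)"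
  using bessel_zero(3)[of \<mu>] by (auto simp: set_eq_iff)

lemma bessel_E_bessel_zero: "0 \<le> \<mu> \<Longrightarrow> bessel_E \<mu> (bessel_zero \<mu> (Suc n)) = 0"
  using bessel_zero(3)[of \<mu>] by (auto simp: set_eq_iff)

lemma bessel_zero_less_Suc: "0 \<le> \<mu> \<Longrightarrow> bessel_zero \<mu> n < bessel_zero \<mu> (Suc n)"
  using bessel_zero(2)[of \<mu>] by (simp add: strict_mono_Suc_iff)

lemma bessel_E_nonzero_between:
  assumes "0 \<le> \<mu>" "bessel_zero \<mu> n < z" "z < bessel_zero \<mu> (Suc n)"
  shows "bessel_E \<mu> z \<noteq> 0"
proof
  assume "bessel_E \<mu> z = 0"
  moreover have "0 < z" using assms bessel_zero_nonneg[of \<mu> n] by linarith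
  ultimately obtain m where "z = bessel_zero \<mu> (Suc m)"
    using bessel_zero(3)[OF assms(1)] by auto
  then show False using assms bessel_zero(2)[OF assms(1)] by (auto simp: strict_mono_less)
qed

text \<open>At a zero of E only the last summand of Q survives, and Q > 0. So the positive zeros of
  E are simple.\<close>

lemma bessel_E_Suc_nonzero:
  assumes "0 \<le> \<mu>" "0 < (z::real)" "bessel_E \<mu> z = 0"
  shows "bessel_E (\<mu> + 1) z \<noteq> 0"
  using bessel_Q_pos[OF assms(1,2)] assms(3) by (auto simp: bessel_Q_def)

lemma bessel_h_strict_mono:
  assumes "0 \<le> \<mu>" "0 \<le> (x::real)" "x < y" and nz: "\<And>z. x \<le> z \<Longrightarrow> z \<le> y \<Longrightarrow> bessel_E \<mu> z \<noteq> 0"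
  shows "bessel_h \<mu> x < bessel_h \<mu> y"
proof (rule DERIV_pos_imp_increasing_open[OF assms(3)])
  fix z assume z: "x < z" "z < y"
  then have "0 < bessel_Q \<mu> z" and e: "bessel_E \<mu> z \<noteq> 0"
    using assms by (auto intro!: bessel_Q_pos)
  then have "0 < 2 * bessel_Q \<mu> z / (bessel_E \<mu> z)\<^sup>2" by simp
  then show "\<exists>D. (bessel_h \<mu> has_real_derivative D) (at z) \<and> D > 0"
    using DERIV_bessel_h[OF assms(1) e] by blast
next
  show "continuous_on {x..y} (bessel_h \<mu>)"
    unfolding bessel_h_def[abs_def] using assms(1) nz by (intro continuous_intros) auto
qed

lemma bessel_h_strict_mono_between:
  assumes "0 \<le> \<mu>" "bessel_zero \<mu> n < x" "x < y" "y < bessel_zero \<mu> (Suc n)"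
  shows "bessel_h \<mu> x < bessel_h \<mu> y"
  using assms bessel_E_nonzero_between[OF assms(1), of n] bessel_zero_nonneg[of \<mu> n]
  by (intro bessel_h_strict_mono) auto

text \<open>h vanishes at 0, and E is nonzero there too, so the increase of h can be started at the
  left end of the first interval.\<close>

lemma bessel_h_pos:
  assumes "0 \<le> \<mu>" "0 < z" "z < bessel_zero \<mu> 1"
  shows "0 < bessel_h \<mu> z"
proof -
  have "bessel_h \<mu> 0 < bessel_h \<mu> z"
  proof (rule bessel_h_strict_mono)
    fix x assume "0 \<le> x" "x \<le> z"
    then show "bessel_E \<mu> x \<noteq> 0"
      using bessel_E_nonzero_between[OF assms(1), of 0 x] bessel_E_0_pos[OF assms(1)] assms bessel_zero(1)
      by (cases "x = 0") (auto simp del: bessel_E_0)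
  qed (use assms in auto)
  then show ?thesis by (simp add: bessel_h_def)
qed

text \<open>Clearing the denominator adds no roots at the poles of h: where E vanishes, the
  left-hand side is a nonzero multiple of the E of order \<mu> + 1.\<close>

lemma bessel_h_eq_iff:
  assumes "0 \<le> \<mu>" "0 < (z::real)"
  shows "\<beta> * bessel_E \<mu> z - 2 * z * bessel_E (\<mu> + 1) z = 0 \<longleftrightarrow> bessel_E \<mu> z \<noteq> 0 \<and> bessel_h \<mu> z = \<beta>"
  using bessel_E_Suc_nonzero[OF assms] assms(2)
  by (cases "bessel_E \<mu> z = 0") (auto simp: bessel_h_def field_simps)

text \<open>The intermediate value theorem is applied to \<open>?F\<close>, which stays continuous
  at the poles where h does not. For n = 0 the value \<beta> must be positive, since h is positive
  on the first interval.\<close>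

lemma bessel_h_surj_between:
  assumes "0 \<le> \<mu>" "0 < \<beta> \<or> 0 < n"
  shows "\<exists>z. bessel_zero \<mu> n < z \<and> z < bessel_zero \<mu> (Suc n) \<and> bessel_h \<mu> z = \<beta>"
proof -
  let ?a = "bessel_zero \<mu> n" and ?b = "bessel_zero \<mu> (Suc n)"
  let ?F = "\<lambda>z::real. \<beta> * bessel_E \<mu> z - 2 * z * bessel_E (\<mu> + 1) z"
  have ab: "0 \<le> ?a" "?a < ?b" "0 < ?b" "bessel_E \<mu> ?b = 0"
    using assms(1) by (auto simp: bessel_zero_nonneg bessel_zero_less_Suc bessel_zero_Suc_pos bessel_E_bessel_zero)
  have cont: "continuous_on A (bessel_E \<mu> :: real \<Rightarrow> real)" for A
    using assms(1) by (intro continuous_intros)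
  note nz = bessel_E_nonzero_between[OF assms(1), of n]
  have fb: "bessel_E (\<mu> + 1) ?b \<noteq> 0" using bessel_E_Suc_nonzero assms(1) ab by blast
  have "?F ?a * ?F ?b < 0"
  proof (cases n)
    case 0
    then have a: "?a = 0" and "0 < \<beta>" using assms bessel_zero(1) by auto
    \<comment> \<open>E starts positive at 0, so its slope at the first zero is not positive. This
      fixes the sign of \<open>?F\<close> at the right end, while at 0 it is that of
      \<beta>.\<close>
    have "- bessel_E (\<mu> + 1) ?b \<le> 0"
      using deriv_nonpos_at_right_zero[OF ab(2) cont DERIV_bessel_E[OF assms(1)] ab(4)]
        nz bessel_E_0_pos[OF assms(1)] unfolding a by blast
    then have "0 < bessel_E (\<mu> + 1) ?b" using fb by simp
    then show ?thesis
      unfolding a ab(4) using bessel_E_0_pos[OF assms(1)] \<open>0 < \<beta>\<close> ab by (simp add: mult_pos_pos del: bessel_E_0)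
  next
    case (Suc m)
    then have a: "0 < ?a" "bessel_E \<mu> ?a = 0"
      using assms(1) by (auto simp: bessel_zero_Suc_pos bessel_E_bessel_zero)
    then have fa: "bessel_E (\<mu> + 1) ?a \<noteq> 0" using bessel_E_Suc_nonzero assms(1) by blast
    \<comment> \<open>E has opposite slopes at consecutive zeros, and up to a positive factor
      \<open>?F\<close> equals the slope there.\<close>
    have "- bessel_E (\<mu> + 1) ?a * - bessel_E (\<mu> + 1) ?b \<le> 0"
      using deriv_mult_nonpos_consecutive_zeros[OF ab(2) cont a(2) ab(4) DERIV_bessel_E[OF assms(1)]
          DERIV_bessel_E[OF assms(1)]] nz by blast
    then have "bessel_E (\<mu> + 1) ?a * bessel_E (\<mu> + 1) ?b < 0"
      using fa fb by (simp add: order_less_le)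
    moreover have "0 < 4 * ?a * ?b" using a ab by simp
    ultimately have "(4 * ?a * ?b) * (bessel_E (\<mu> + 1) ?a * bessel_E (\<mu> + 1) ?b) < 0"
      by (simp add: mult_pos_neg del: mult_less_0_iff)
    moreover have "?F ?a * ?F ?b = (4 * ?a * ?b) * (bessel_E (\<mu> + 1) ?a * bessel_E (\<mu> + 1) ?b)"
      unfolding a(2) ab(4) by (simp only: mult_zero_right diff_0 minus_mult_minus) (simp add: algebra_simps)
    ultimately show ?thesis by (simp only:)
  qed
  moreover have "continuous_on {?a..?b} ?F" using assms(1) by (intro continuous_intros) auto
  ultimately obtain z where z: "?a < z" "z < ?b" "?F z = 0"
    using IVT_opposite_signs[OF ab(2)] by blast
  then have "bessel_h \<mu> z = \<beta>" using bessel_h_eq_iff[OF assms(1), of z \<beta>] ab(1) by linarith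
  then show ?thesis using z by blast
qed

section \<open>The branches as inverses of h on the intervals between zeros\<close>

definition robin_zero :: "real \<Rightarrow> nat \<Rightarrow> real \<Rightarrow> real" where
  "robin_zero \<mu> n \<beta> = (THE z. bessel_zero \<mu> n < z \<and> z < bessel_zero \<mu> (Suc n) \<and> bessel_h \<mu> z = \<beta>)"

lemma robin_zero:
  assumes "0 \<le> \<mu>" "0 < \<beta> \<or> 0 < n"
  shows "bessel_zero \<mu> n < robin_zero \<mu> n \<beta>" "robin_zero \<mu> n \<beta> < bessel_zero \<mu> (Suc n)"
    "bessel_h \<mu> (robin_zero \<mu> n \<beta>) = \<beta>"
proof -
  let ?P = "\<lambda>z. bessel_zero \<mu> n < z \<and> z < bessel_zero \<mu> (Suc n) \<and> bessel_h \<mu> z = \<beta>"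
  have "\<exists>!z. ?P z"
  proof (rule ex_ex1I)
    show "Ex ?P" using assms by (rule bessel_h_surj_between)
    show "x = y" if "?P x" "?P y" for x y
      using bessel_h_strict_mono_between[OF assms(1), of n x y]
        bessel_h_strict_mono_between[OF assms(1), of n y x] that
      by (cases x y rule: linorder_cases) auto
  qed
  then have "?P (robin_zero \<mu> n \<beta>)" unfolding robin_zero_def by (rule theI')
  then show "bessel_zero \<mu> n < robin_zero \<mu> n \<beta>" "robin_zero \<mu> n \<beta> < bessel_zero \<mu> (Suc n)"
    "bessel_h \<mu> (robin_zero \<mu> n \<beta>) = \<beta>" by auto
qed

lemma robin_zero_pos: "0 \<le> \<mu> \<Longrightarrow> 0 < \<beta> \<or> 0 < n \<Longrightarrow> 0 < robin_zero \<mu> n \<beta>"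
  using robin_zero(1)[of \<mu> \<beta> n] bessel_zero_nonneg[of \<mu> n] by linarith

text \<open>Comparing a point with the root amounts to comparing values of h, as h increases on the
  interval. Continuity and limits of the branches all reduce to this.\<close>

lemma robin_zero_less_iff:
  assumes "0 \<le> \<mu>" "0 < \<beta> \<or> 0 < n" "bessel_zero \<mu> n < z" "z < bessel_zero \<mu> (Suc n)"
  shows "robin_zero \<mu> n \<beta> < z \<longleftrightarrow> \<beta> < bessel_h \<mu> z" "z < robin_zero \<mu> n \<beta> \<longleftrightarrow> bessel_h \<mu> z < \<beta>"
    "z = robin_zero \<mu> n \<beta> \<longleftrightarrow> bessel_h \<mu> z = \<beta>"
  using robin_zero[OF assms(1,2)] bessel_h_strict_mono_between[OF assms(1), of n z "robin_zero \<mu> n \<beta>"]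
    bessel_h_strict_mono_between[OF assms(1), of n "robin_zero \<mu> n \<beta>" z] assms(3,4)
  by (cases z "robin_zero \<mu> n \<beta>" rule: linorder_cases; auto)+

lemma robin_zero_strict_mono:
  assumes "0 \<le> \<mu>" "0 < \<beta> \<or> 0 < n" "\<beta> < \<gamma>"
  shows "robin_zero \<mu> n \<beta> < robin_zero \<mu> n \<gamma>"
proof -
  have "0 < \<gamma> \<or> 0 < n" using assms by auto
  then show ?thesis
    using robin_zero[OF assms(1,2)] robin_zero_less_iff(2)[OF assms(1), of \<gamma> n "robin_zero \<mu> n \<beta>"] assms
    by simp
qed

lemma isCont_robin_zero:
  assumes "0 \<le> \<mu>" "0 < \<beta> \<or> 0 < n"
  shows "isCont (robin_zero \<mu> n) \<beta>"
  unfolding isCont_def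
proof (rule order_tendstoI)
  note rz = robin_zero[OF assms]
  \<comment> \<open>On the first interval the branch is meaningful only for positive parameters, so
    the neighbourhood of \<beta> is cut down to them.\<close>
  have valid: "\<forall>\<^sub>F b in at \<beta>. 0 < b \<or> 0 < n"
    using assms(2) order_tendstoD(1)[OF tendsto_ident_at[of \<beta> UNIV], of 0]
    by (cases "0 < n") (auto elim: eventually_mono)
  fix a assume "a < robin_zero \<mu> n \<beta>"
  \<comment> \<open>A z between a and the root, inside the interval: h z < \<beta> persists for
    nearby parameters and keeps their roots above z, hence above a.\<close>
  then obtain z where z: "max a (bessel_zero \<mu> n) < z" "z < robin_zero \<mu> n \<beta>"
    using rz dense[of "max a (bessel_zero \<mu> n)" "robin_zero \<mu> n \<beta>"] by auto
  then have "bessel_h \<mu> z < \<beta>" using robin_zero_less_iff(2)[OF assms, of z] rz by auto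
  then have "\<forall>\<^sub>F b in at \<beta>. bessel_h \<mu> z < b" by (rule order_tendstoD[OF tendsto_ident_at])
  then show "\<forall>\<^sub>F b in at \<beta>. a < robin_zero \<mu> n b"
    using valid
  proof eventually_elim
    case (elim b)
    then have "z < robin_zero \<mu> n b"
      using robin_zero_less_iff(2)[OF assms(1), of b n z] z rz by simp
    then show ?case using z by simp
  qed
next
  note rz = robin_zero[OF assms]
  have valid: "\<forall>\<^sub>F b in at \<beta>. 0 < b \<or> 0 < n"
    using assms(2) order_tendstoD(1)[OF tendsto_ident_at[of \<beta> UNIV], of 0]
    by (cases "0 < n") (auto elim: eventually_mono)
  fix a assume "robin_zero \<mu> n \<beta> < a"
  then obtain z where z: "z < min a (bessel_zero \<mu> (Suc n))" "robin_zero \<mu> n \<beta> < z"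
    using rz dense[of "robin_zero \<mu> n \<beta>" "min a (bessel_zero \<mu> (Suc n))"] by auto
  then have "\<beta> < bessel_h \<mu> z" using robin_zero_less_iff(1)[OF assms, of z] rz by auto
  then have "\<forall>\<^sub>F b in at \<beta>. b < bessel_h \<mu> z" by (rule order_tendstoD[OF tendsto_ident_at])
  then show "\<forall>\<^sub>F b in at \<beta>. robin_zero \<mu> n b < a"
    using valid
  proof eventually_elim
    case (elim b)
    then have "robin_zero \<mu> n b < z"
      using robin_zero_less_iff(1)[OF assms(1), of b n z] z rz by simp
    then show ?case using z by simp
  qed
qed

text \<open>The one limit not covered by \<open>isCont_robin_zero\<close>: the first branch has no
  root at \<beta> = 0. Every z in the first interval has h z > 0, so small \<beta> forces the root
  below z.\<close>

lemma robin_zero_tendsto_0: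
  assumes "0 \<le> \<mu>"
  shows "(robin_zero \<mu> 0 \<longlongrightarrow> 0) (at_right 0)"
proof (rule order_tendstoI)
  note D = bessel_zero(1)[OF assms] bessel_zero_Suc_pos[OF assms, of 0]
  have gt0: "\<forall>\<^sub>F b::real in at_right 0. 0 < b" by (rule eventually_at_right_less)
  show "\<forall>\<^sub>F b in at_right 0. a < robin_zero \<mu> 0 b" if "a < 0" for a
    using gt0 by (rule eventually_mono) (use robin_zero_pos[OF assms, of _ 0] that in \<open>blast intro: less_trans\<close>)
  fix a :: real assume "0 < a"
  then obtain z where z: "z < min a (bessel_zero \<mu> 1)" "0 < z"
    using D dense[of 0 "min a (bessel_zero \<mu> 1)"] by auto
  have "\<forall>\<^sub>F b in at_right 0. b < bessel_h \<mu> z"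
    using bessel_h_pos[OF assms, of z] z by (intro order_tendstoD[OF tendsto_ident_at]) auto
  then show "\<forall>\<^sub>F b in at_right 0. robin_zero \<mu> 0 b < a"
    using gt0
  proof eventually_elim
    case (elim b)
    then have "robin_zero \<mu> 0 b < z"
      using robin_zero_less_iff(1)[OF assms, of b 0 z] z D by simp
    then show ?case using z by simp
  qed
qed

lemma robin_zero_tendsto_bessel_zero:
  assumes "0 \<le> \<mu>"
  shows "(robin_zero \<mu> n \<longlongrightarrow> bessel_zero \<mu> (Suc n)) at_top"
proof (rule order_tendstoI)
  have gt0: "\<forall>\<^sub>F b::real in at_top. 0 < b" by (rule eventually_gt_at_top)
  show "\<forall>\<^sub>F b in at_top. robin_zero \<mu> n b < a" if "bessel_zero \<mu> (Suc n) < a" for a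
    using gt0 by (rule eventually_mono) (use robin_zero(2)[OF assms, of _ n] that in \<open>blast intro: less_trans\<close>)
  fix a assume "a < bessel_zero \<mu> (Suc n)"
  then obtain z where z: "max a (bessel_zero \<mu> n) < z" "z < bessel_zero \<mu> (Suc n)"
    using dense[of "max a (bessel_zero \<mu> n)" "bessel_zero \<mu> (Suc n)"] bessel_zero_less_Suc[OF assms, of n] by auto
  show "\<forall>\<^sub>F b in at_top. a < robin_zero \<mu> n b"
    using gt0 eventually_gt_at_top[of "bessel_h \<mu> z"]
  proof eventually_elim
    case (elim b)
    then have "z < robin_zero \<mu> n b"
      using robin_zero_less_iff(2)[OF assms(1), of b n z] z by simp
    then show ?case using z by simp
  qed
qed

lemma strict_mono_robin_zero_index:
  assumes "0 \<le> \<mu>" "0 < \<beta> \<or> 0 < m"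
  shows "strict_mono (\<lambda>n. robin_zero \<mu> (n + m) \<beta>)"
proof -
  have "robin_zero \<mu> (n + m) \<beta> < robin_zero \<mu> (Suc n + m) \<beta>" for n
    using robin_zero(2)[OF assms(1), of \<beta> "n + m"] robin_zero(1)[OF assms(1), of \<beta> "Suc n + m"] assms(2)
    by auto
  then show ?thesis by (simp add: strict_mono_Suc_iff)
qed

lemma bessel_zero_interval_cases:
  assumes "0 \<le> \<mu>" "0 < z" "bessel_E \<mu> z \<noteq> 0"
  obtains n where "bessel_zero \<mu> n < z" "z < bessel_zero \<mu> (Suc n)"
proof -
  obtain n where n: "z \<le> bessel_zero \<mu> n"
    using bessel_zero(4)[OF assms(1)] by (auto simp: filterlim_at_top eventually_sequentially)
  define m where "m = (LEAST n. z \<le> bessel_zero \<mu> n)"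
  have m: "z \<le> bessel_zero \<mu> m" using n unfolding m_def by (rule LeastI)
  then have "m \<noteq> 0" using bessel_zero(1)[OF assms(1)] assms(2) by (intro notI) auto
  then obtain k where k: "m = Suc k" by (cases m) auto
  then have "bessel_zero \<mu> k < z" using not_less_Least[of k "\<lambda>n. z \<le> bessel_zero \<mu> n"] by (simp add: m_def)
  moreover have "z \<noteq> bessel_zero \<mu> (Suc k)" using assms bessel_E_bessel_zero by auto
  ultimately show thesis using that[of k] m k by simp
qed

text \<open>For \<^term>\<open>\<beta> = 0\<close> the root in the first interval has moved to the origin.\<close>

lemma robin_zeros:
  assumes "0 \<le> \<mu>" "0 \<le> \<beta>" and m: "m = (if \<beta> = 0 then 1 else 0)"
  shows "{z. 0 < z \<and> \<beta> * bessel_E \<mu> z - 2 * z * bessel_E (\<mu> + 1) z = 0} = range (\<lambda>n. robin_zero \<mu> (n + m) \<beta>)"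
    (is "?L = ?R")
proof -
  have valid: "0 < \<beta> \<or> 0 < n + m" for n using assms by auto
  show ?thesis
  proof (intro equalityI subsetI)
    fix z assume "z \<in> ?L"
    then have z: "0 < z" "bessel_E \<mu> z \<noteq> 0" "bessel_h \<mu> z = \<beta>"
      using bessel_h_eq_iff[OF assms(1)] by auto
    then obtain n where n: "bessel_zero \<mu> n < z" "z < bessel_zero \<mu> (Suc n)"
      using bessel_zero_interval_cases[OF assms(1)] by blast
    \<comment> \<open>h is positive on the first interval, so a root for \<beta> = 0 lies further
      right; this also makes the subtraction \<open>n - m\<close> exact.\<close>
    have "0 < n" if "\<beta> = 0"
      using bessel_h_pos[OF assms(1) z(1)] n z(3) that by (cases n) auto
    then have "m \<le> n" "0 < \<beta> \<or> 0 < n" using assms by (cases "\<beta> = 0"; auto)+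
    then have "z = robin_zero \<mu> ((n - m) + m) \<beta>"
      using robin_zero_less_iff(3)[OF assms(1) _ n] z by simp
    then show "z \<in> ?R" by blast
  next
    fix z assume "z \<in> ?R"
    then obtain n where n: "z = robin_zero \<mu> (n + m) \<beta>" by auto
    note rz = robin_zero[OF assms(1) valid[of n], folded n]
    have "bessel_E \<mu> z \<noteq> 0" "0 < z"
      using bessel_E_nonzero_between[OF assms(1) rz(1,2)] robin_zero_pos[OF assms(1) valid] n by auto
    then show "z \<in> ?L" using bessel_h_eq_iff[OF assms(1)] rz by auto
  qed
qed

section \<open>From the variable z back to wavenumbers\<close>

lemma scaled_square_zeros:
  assumes "0 < (R::real)" "{z. 0 < z \<and> P z} = range s"
  shows "{k. 0 < k \<and> P ((k * R / 2)\<^sup>2)} = range (\<lambda>n. 2 * sqrt (s n) / R)"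
proof (intro equalityI subsetI)
  fix k assume "k \<in> {k. 0 < k \<and> P ((k * R / 2)\<^sup>2)}"
  then have k: "0 < k" "(k * R / 2)\<^sup>2 \<in> {z. 0 < z \<and> P z}" using assms(1) by auto
  then obtain n where "(k * R / 2)\<^sup>2 = s n" unfolding assms(2) by auto
  then have "sqrt (s n) = k * R / 2" using k assms(1) by (intro real_sqrt_unique) auto
  then have "k = 2 * sqrt (s n) / R" using assms(1) by (simp add: field_simps)
  then show "k \<in> range (\<lambda>n. 2 * sqrt (s n) / R)" by blast
next
  fix k assume "k \<in> range (\<lambda>n. 2 * sqrt (s n) / R)"
  then obtain n where n: "k = 2 * sqrt (s n) / R" by auto
  have "s n \<in> {z. 0 < z \<and> P z}" unfolding assms(2) by auto
  then show "k \<in> {k. 0 < k \<and> P ((k * R / 2)\<^sup>2)}" using n assms(1) by auto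
qed

lemma strict_mono_scaled_sqrt:
  assumes "0 < (R::real)" "strict_mono s"
  shows "strict_mono (\<lambda>n. 2 * sqrt (s n) / R)"
  using assms by (auto simp: strict_mono_def divide_strict_right_mono)

text \<open>Both Bessel functions carry the positive factor (k R / 2)^\<mu>; the extra k R / 2 of
  the higher order combines with k to 2 z / R.\<close>

lemma robin_det_eq_bessel_E:
  assumes "0 \<le> \<mu>" "0 < R" "0 < k"
  shows "robin_det l \<mu> R k \<alpha> = (k * R / 2) powr \<mu> / R *
    ((\<alpha> * R + real l) * bessel_E \<mu> ((k * R / 2)\<^sup>2) - 2 * (k * R / 2)\<^sup>2 * bessel_E (\<mu> + 1) ((k * R / 2)\<^sup>2))"
proof -
  have kR: "0 < k * R" "0 \<le> \<mu> + 1" using assms by auto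
  have p: "(k * R / 2) powr (\<mu> + 1) = (k * R / 2) * (k * R / 2) powr \<mu>"
    using kR by (simp add: powr_add)
  show ?thesis
    unfolding robin_det_def bessel_J_eq_bessel_E[OF assms(1) kR(1)] bessel_J_eq_bessel_E[OF kR(2) kR(1)] p
    using assms by (simp add: field_simps power2_eq_square)
qed

text \<open>Admitting \<alpha> = 0 lets the Neumann equation be the instance R = 1. The offset m
  drops the first branch exactly when \<alpha> R + l = 0.\<close>

lemma robin_det_roots:
  assumes "0 \<le> \<mu>" "0 < R" "0 \<le> \<alpha>"
    and m: "m = (if \<alpha> = 0 \<and> l = 0 then 1 else 0)"
  shows "{k. 0 < k \<and> robin_det l \<mu> R k \<alpha> = 0}
    = range (\<lambda>n. 2 * sqrt (robin_zero \<mu> (n + m) (\<alpha> * R + real l)) / R)"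
proof -
  have "m = (if \<alpha> * R + real l = 0 then 1 else 0)"
    using assms by (auto simp: add_nonneg_eq_0_iff)
  then have "{z. 0 < z \<and> (\<alpha> * R + real l) * bessel_E \<mu> z - 2 * z * bessel_E (\<mu> + 1) z = 0}
      = range (\<lambda>n. robin_zero \<mu> (n + m) (\<alpha> * R + real l))"
    using assms by (intro robin_zeros) auto
  note roots = scaled_square_zeros[OF assms(2) this]
  show ?thesis
    unfolding roots[symmetric] using robin_det_eq_bessel_E[OF assms(1,2), of _ l \<alpha>] assms(2) by auto
qed

lemma strict_mono_robin_det_roots:
  assumes "0 \<le> \<mu>" "0 < R" "0 \<le> \<alpha>"
    and m: "m = (if \<alpha> = 0 \<and> l = 0 then 1 else 0)"
  shows "strict_mono (\<lambda>n. 2 * sqrt (robin_zero \<mu> (n + m) (\<alpha> * R + real l)) / R)"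
proof -
  have "0 < \<alpha> * R + real l \<or> 0 < m"
    using assms by (cases "\<alpha> = 0") (auto simp: add_pos_nonneg)
  then show ?thesis
    by (intro strict_mono_scaled_sqrt assms strict_mono_robin_zero_index)
qed

lemma robin_root_eq:
  assumes "0 \<le> \<mu>" "0 < R" "0 < \<alpha>"
  shows "is_pos_root (\<lambda>k. robin_det l \<mu> R k \<alpha>) (Suc n) (robin_root l \<mu> R (Suc n) \<alpha>)"
    "robin_root l \<mu> R (Suc n) \<alpha> = 2 * sqrt (robin_zero \<mu> n (\<alpha> * R + real l)) / R"
proof -
  have "strict_mono (\<lambda>n. 2 * sqrt (robin_zero \<mu> n (\<alpha> * R + real l)) / R)"
    and "{k. 0 < k \<and> robin_det l \<mu> R k \<alpha> = 0} = range (\<lambda>n. 2 * sqrt (robin_zero \<mu> n (\<alpha> * R + real l)) / R)"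
    using strict_mono_robin_det_roots[OF assms(1,2), of \<alpha> 0 l] robin_det_roots[OF assms(1,2), of \<alpha> 0 l] assms
    by auto
  from is_pos_root_enum[OF this] pos_root_enum[OF this]
  show "is_pos_root (\<lambda>k. robin_det l \<mu> R k \<alpha>) (Suc n) (robin_root l \<mu> R (Suc n) \<alpha>)"
    "robin_root l \<mu> R (Suc n) \<alpha> = 2 * sqrt (robin_zero \<mu> n (\<alpha> * R + real l)) / R"
    by (auto simp: robin_root_def)
qed

lemma neumann_fun_eq_robin_det: "neumann_fun l \<mu> x = robin_det l \<mu> 1 x 0"
  by (simp add: neumann_fun_def robin_det_def)

lemma pos_root_neumann_fun:
  assumes "0 \<le> \<mu>"
  shows "is_pos_root (neumann_fun l \<mu>) (Suc n) (pos_root (neumann_fun l \<mu>) (Suc n))"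
    "pos_root (neumann_fun l \<mu>) (Suc n) = 2 * sqrt (robin_zero \<mu> (n + (if l = 0 then 1 else 0)) (real l))"
proof -
  let ?s = "\<lambda>n. 2 * sqrt (robin_zero \<mu> (n + (if l = 0 then 1 else 0)) (real l))"
  have "strict_mono ?s" "{x. 0 < x \<and> neumann_fun l \<mu> x = 0} = range ?s"
    using strict_mono_robin_det_roots[OF assms, of 1 0 _ l] robin_det_roots[OF assms, of 1 0 _ l]
    by (auto simp: neumann_fun_eq_robin_det)
  from is_pos_root_enum[OF this] pos_root_enum[OF this]
  show "is_pos_root (neumann_fun l \<mu>) (Suc n) (pos_root (neumann_fun l \<mu>) (Suc n))"
    "pos_root (neumann_fun l \<mu>) (Suc n) = ?s n"
    by auto
qed

text \<open>For \<open>l = 0\<close> the shift in \<open>neumann_root\<close> cancels the missing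
  first branch, so Neumann root n + 1 always belongs to branch n, as the Robin root does.\<close>

lemma neumann_root_eq:
  assumes "0 \<le> \<mu>"
  shows "neumann_root l \<mu> (Suc n) = (if l = 0 \<and> n = 0 then 0 else 2 * sqrt (robin_zero \<mu> n (real l)))"
  using pos_root_neumann_fun(2)[OF assms, of l n] pos_root_neumann_fun(2)[OF assms, of l "n - 1"]
  by (cases n) (auto simp: neumann_root_def)

lemma dirichlet_root_eq:
  assumes "0 \<le> \<mu>"
  shows "is_pos_root (bessel_J \<mu>) (Suc n) (dirichlet_root \<mu> (Suc n))"
    "dirichlet_root \<mu> (Suc n) = 2 * sqrt (bessel_zero \<mu> (Suc n))"
proof -
  let ?s = "\<lambda>n. 2 * sqrt (bessel_zero \<mu> (Suc n))"
  have "strict_mono ?s"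
    using bessel_zero(2)[OF assms] strict_mono_scaled_sqrt[of 1 "\<lambda>n. bessel_zero \<mu> (Suc n)"]
    by (auto simp: strict_mono_def)
  moreover have "range ?s = {k. 0 < k \<and> bessel_E \<mu> ((k / 2)\<^sup>2) = 0}"
    using scaled_square_zeros[of 1, OF _ bessel_zero(3)[OF assms]] by simp
  then have "{x. 0 < x \<and> bessel_J \<mu> x = 0} = range ?s"
    using bessel_J_eq_bessel_E[OF assms] by auto
  ultimately show "is_pos_root (bessel_J \<mu>) (Suc n) (dirichlet_root \<mu> (Suc n))"
    "dirichlet_root \<mu> (Suc n) = ?s n"
    unfolding dirichlet_root_def by (simp_all add: is_pos_root_enum pos_root_enum)
qed

lemma DERIV_bessel_J:
  assumes "0 \<le> \<mu>" "0 < x"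
  shows "(bessel_J \<mu> has_real_derivative \<mu> / x * bessel_J \<mu> x - bessel_J (\<mu> + 1) x) (at x)"
proof -
  let ?z = "(x / 2)\<^sup>2"
  have "((\<lambda>x. (x / 2) powr \<mu> * bessel_E \<mu> ((x / 2)\<^sup>2)) has_real_derivative
      \<mu> / x * ((x / 2) powr \<mu> * bessel_E \<mu> ?z) - (x / 2) powr (\<mu> + 1) * bessel_E (\<mu> + 1) ?z) (at x)"
  proof (rule DERIV_cong)
    show "((\<lambda>x. (x / 2) powr \<mu> * bessel_E \<mu> ((x / 2)\<^sup>2)) has_real_derivative
        (\<mu> * (x / 2) powr (\<mu> - 1) * (1 / 2)) * bessel_E \<mu> ?z
        + (x / 2) powr \<mu> * (- bessel_E (\<mu> + 1) ?z * (x / 2))) (at x)"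
      using assms by (auto intro!: derivative_eq_intros)
    show "(\<mu> * (x / 2) powr (\<mu> - 1) * (1 / 2)) * bessel_E \<mu> ?z
        + (x / 2) powr \<mu> * (- bessel_E (\<mu> + 1) ?z * (x / 2))
        = \<mu> / x * ((x / 2) powr \<mu> * bessel_E \<mu> ?z) - (x / 2) powr (\<mu> + 1) * bessel_E (\<mu> + 1) ?z"
      using assms by (simp add: powr_add powr_diff mult_ac)
  qed
  then have "((\<lambda>x. (x / 2) powr \<mu> * bessel_E \<mu> ((x / 2)\<^sup>2)) has_real_derivative
      \<mu> / x * bessel_J \<mu> x - bessel_J (\<mu> + 1) x) (at x)"
    using assms by (simp add: bessel_J_eq_bessel_E)
  then show ?thesis
    by (rule has_field_derivative_transform_within_open[where S = "{0<..}"])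
      (use assms in \<open>auto simp: bessel_J_eq_bessel_E\<close>)
qed

lemma neumann_fun_eq_0_iff:
  assumes "0 \<le> \<mu>" "0 < x" "\<mu> = real l + \<nu>"
  shows "neumann_fun l \<mu> x = 0 \<longleftrightarrow> (bessel_J \<mu> has_real_derivative \<nu> / x * bessel_J \<mu> x) (at x)"
proof -
  have "(bessel_J \<mu> has_real_derivative \<nu> / x * bessel_J \<mu> x) (at x)
      \<longleftrightarrow> \<nu> / x * bessel_J \<mu> x = \<mu> / x * bessel_J \<mu> x - bessel_J (\<mu> + 1) x"
    using DERIV_bessel_J[OF assms(1,2)] DERIV_unique by metis
  also have "\<dots> \<longleftrightarrow> neumann_fun l \<mu> x = 0"
    using assms(2,3) by (auto simp: neumann_fun_def field_simps)
  finally show ?thesis ..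
qed

section \<open>Analyticity\<close>

text \<open>The Taylor series of the holomorphic extension converges on the whole ball. At real
  points the powers of x - a are real, so taking real parts of the coefficients gives the real
  series.\<close>

lemma real_analytic_onI_holomorphic:
  assumes "\<And>a. a \<in> S \<Longrightarrow> \<exists>e>0. \<exists>F. F holomorphic_on ball (of_real a) e \<and>
    (\<forall>x. \<bar>x - a\<bar> < e \<longrightarrow> F (of_real x) = complex_of_real (f x))"
  shows "real_analytic_on f S"
  unfolding real_analytic_on_def
proof
  fix a assume "a \<in> S"
  then obtain e F where F: "0 < e" "F holomorphic_on ball (of_real a) e"
    "\<And>x. \<bar>x - a\<bar> < e \<Longrightarrow> F (of_real x) = complex_of_real (f x)"
    using assms by blast
  define c where "c n = Re ((deriv ^^ n) F (of_real a) / fact n)" for n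
  have "(\<lambda>n. c n * (x - a) ^ n) sums f x" if x: "\<bar>x - a\<bar> < e" for x
  proof -
    have "(of_real x :: complex) \<in> ball (of_real a) e"
      using x by (simp add: dist_norm abs_minus_commute flip: of_real_diff)
    moreover have "Re ((deriv ^^ n) F (of_real a) / fact n * (of_real x - of_real a) ^ n) = c n * (x - a) ^ n" for n
      unfolding c_def of_real_diff[symmetric] of_real_power[symmetric] times_complex.sel by simp
    ultimately show ?thesis
      using sums_Re[OF holomorphic_power_series[OF F(2), of "of_real x"]] F(3)[OF x] by simp
  qed
  then show "\<exists>c. \<exists>e>0. \<forall>x. \<bar>x - a\<bar> < e \<longrightarrow> (\<lambda>n. c n * (x - a) ^ n) sums f x"
    using F(1) by blast
qed

text \<open>H has a holomorphic inverse g near \<rho> a. Continuity of \<rho> keeps \<rho> x in the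
  ball on which H is injective, and there H (\<rho> x) = x identifies \<rho> with g on the
  reals.\<close>

lemma holomorphic_local_inverse_extends:
  assumes H: "H holomorphic_on S" "open S" "of_real (\<rho> a) \<in> S" "deriv H (of_real (\<rho> a)) \<noteq> 0"
    and \<rho>: "isCont \<rho> a" "\<forall>\<^sub>F x in nhds a. H (of_real (\<rho> x)) = complex_of_real x"
  shows "\<exists>e>0. \<exists>F. F holomorphic_on ball (of_real a) e \<and>
    (\<forall>x. \<bar>x - a\<bar> < e \<longrightarrow> F (of_real x) = complex_of_real (\<rho> x))"
proof -
  obtain r where r: "0 < r" "ball (of_real (\<rho> a)) r \<subseteq> S" "open (H ` ball (of_real (\<rho> a)) r)"
    "inj_on H (ball (of_real (\<rho> a)) r)"
    by (rule has_complex_derivative_locally_invertible[OF H(1,3,2,4)])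
  let ?B = "ball (complex_of_real (\<rho> a)) r"
  obtain g where g: "g holomorphic_on H ` ?B" "\<And>z. z \<in> ?B \<Longrightarrow> deriv H z * deriv g (H z) = 1"
    "\<And>z. z \<in> ?B \<Longrightarrow> g (H z) = z"
    by (rule holomorphic_has_inverse[OF holomorphic_on_subset[OF H(1) r(2)] open_ball r(4)]) (rule that; simp)
  have "H (of_real (\<rho> a)) = of_real a" using \<rho>(2) by (rule eventually_nhds_x_imp_x)
  then have "of_real a \<in> H ` ?B" using r(1) by (intro image_eqI[of _ _ "of_real (\<rho> a)"]) auto
  then obtain e1 where e1: "0 < e1" "ball (of_real a) e1 \<subseteq> H ` ?B"
    using r(3) unfolding open_contains_ball by blast
  have "\<forall>\<^sub>F x in nhds a. dist (\<rho> x) (\<rho> a) < r"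
    using \<rho>(1) r(1) by (simp add: isCont_def tendsto_iff eventually_nhds_conv_at)
  then have "\<forall>\<^sub>F x in nhds a. \<rho> x \<in> ball (\<rho> a) r \<and> H (of_real (\<rho> x)) = of_real x"
    using \<rho>(2) by eventually_elim (simp add: dist_commute)
  then obtain e2 where e2: "0 < e2"
    "\<And>x. dist x a < e2 \<Longrightarrow> \<rho> x \<in> ball (\<rho> a) r \<and> H (of_real (\<rho> x)) = of_real x"
    unfolding eventually_nhds_metric by blast
  have "g (of_real x) = of_real (\<rho> x)" if "\<bar>x - a\<bar> < min e1 e2" for x
  proof -
    have x: "\<rho> x \<in> ball (\<rho> a) r" "H (of_real (\<rho> x)) = of_real x"
      using e2(2)[of x] that by (auto simp: dist_real_def)
    then have "complex_of_real (\<rho> x) \<in> ?B" by (simp add: dist_norm flip: of_real_diff)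
    from g(3)[OF this] show ?thesis by (simp add: x(2))
  qed
  moreover have "g holomorphic_on ball (of_real a) (min e1 e2)"
    using g(1) by (rule holomorphic_on_subset) (use e1 in auto)
  ultimately show ?thesis using e1(1) e2(1) by (intro exI[of _ "min e1 e2"]) auto
qed

lemma real_analytic_on_powser:
  assumes "real_analytic_on f S" "a \<in> S"
  shows "\<exists>c. \<exists>e>0. \<forall>x. \<bar>x - a\<bar> < e \<longrightarrow> ((\<lambda>n. c n * (x - a) ^ n) has_sum f x) UNIV"
proof -
  obtain c e where ce: "0 < e" "\<And>x. \<bar>x - a\<bar> < e \<Longrightarrow> (\<lambda>n. c n * (x - a) ^ n) sums f x"
    using assms unfolding real_analytic_on_def by blast
  have "((\<lambda>n. c n * (x - a) ^ n) has_sum f x) UNIV" if "\<bar>x - a\<bar> < e" for x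
  proof (rule norm_summable_imp_has_sum)
    \<comment> \<open>Convergence at a point further out gives absolute convergence at x, as the
      unordered \<open>has_sum\<close> requires.\<close>
    obtain t where t: "\<bar>x - a\<bar> < t" "t < e" using dense[OF \<open>\<bar>x - a\<bar> < e\<close>] by blast
    then have "summable (\<lambda>n. c n * t ^ n)" using ce(2)[of "a + t"] by (auto dest: sums_summable)
    then show "summable (\<lambda>n. norm (c n * (x - a) ^ n))"
      by (rule powser_insidea) (use t in simp)
  qed (use ce(2) that in auto)
  then show ?thesis using ce(1) by blast
qed

text \<open>The determinant is affine in \<alpha>, so its double series needs only the columns j = 0
  and j = 1 and no products of series.\<close>

lemma real_analytic2_on_affine:
  assumes A: "real_analytic_on A U" and B: "real_analytic_on B U"
  shows "real_analytic2_on (\<lambda>(k, \<alpha>). \<alpha> * A k + B k) (U \<times> V)"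
  unfolding real_analytic2_on_def
proof
  fix p assume "p \<in> U \<times> V"
  then obtain a b where p: "p = (a, b)" and "a \<in> U" by auto
  obtain c e1 where c: "0 < e1" "\<And>x. \<bar>x - a\<bar> < e1 \<Longrightarrow> ((\<lambda>n. c n * (x - a) ^ n) has_sum A x) UNIV"
    using real_analytic_on_powser[OF A \<open>a \<in> U\<close>] by blast
  obtain d e2 where d: "0 < e2" "\<And>x. \<bar>x - a\<bar> < e2 \<Longrightarrow> ((\<lambda>n. d n * (x - a) ^ n) has_sum B x) UNIV"
    using real_analytic_on_powser[OF B \<open>a \<in> U\<close>] by blast
  \<comment> \<open>Read off from y A + B = (b A + B) + (y - b) A.\<close>
  define C where "C i j = (if j = 0 then b * c i + d i else if j = 1 then c i else 0)" for i j :: nat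
  have "((\<lambda>(i, j). C i j * (x - a) ^ i * (y - b) ^ j) has_sum (case (x, y) of (k, \<alpha>) \<Rightarrow> \<alpha> * A k + B k)) UNIV"
    if "\<bar>x - a\<bar> < min e1 e2 \<and> \<bar>y - b\<bar> < min e1 e2" for x y
  proof -
    let ?g = "\<lambda>(i, j). C i j * (x - a) ^ i * (y - b) ^ j"
    have cx: "((\<lambda>n. c n * (x - a) ^ n) has_sum A x) UNIV" and dx: "((\<lambda>n. d n * (x - a) ^ n) has_sum B x) UNIV"
      using c d that by auto
    have "((\<lambda>i. b * (c i * (x - a) ^ i) + d i * (x - a) ^ i) has_sum (b * A x + B x)) UNIV"
      by (intro has_sum_add has_sum_cmult_right cx dx)
    then have "(?g \<circ> (\<lambda>i. (i, 0)) has_sum (b * A x + B x)) UNIV"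
      by (simp add: o_def C_def algebra_simps)
    then have 0: "(?g has_sum (b * A x + B x)) (range (\<lambda>i. (i, 0)))"
      by (subst has_sum_reindex) (auto simp: inj_on_def)
    have "((\<lambda>i. (y - b) * (c i * (x - a) ^ i)) has_sum ((y - b) * A x)) UNIV"
      by (intro has_sum_cmult_right cx)
    then have "(?g \<circ> (\<lambda>i. (i, 1)) has_sum ((y - b) * A x)) UNIV"
      by (simp add: o_def C_def algebra_simps)
    then have 1: "(?g has_sum ((y - b) * A x)) (range (\<lambda>i. (i, 1)))"
      by (subst has_sum_reindex) (auto simp: inj_on_def)
    have "(?g has_sum ((b * A x + B x) + (y - b) * A x)) (range (\<lambda>i. (i, 0)) \<union> range (\<lambda>i. (i, 1)))"
      by (rule has_sum_Un_disjoint[OF 0 1]) auto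
    also have "(b * A x + B x) + (y - b) * A x = y * A x + B x" by (simp add: algebra_simps)
    also have "(?g has_sum (y * A x + B x)) (range (\<lambda>i. (i, 0)) \<union> range (\<lambda>i. (i, 1)))
        \<longleftrightarrow> (?g has_sum (y * A x + B x)) UNIV"
      by (rule has_sum_cong_neutral) (auto simp: C_def image_iff split: if_splits)
    finally show ?thesis by simp
  qed
  then show "case p of (a, b) \<Rightarrow> \<exists>c. \<exists>e>0. \<forall>x y. \<bar>x - a\<bar> < e \<and> \<bar>y - b\<bar> < e \<longrightarrow>
      ((\<lambda>(i, j). c i j * (x - a) ^ i * (y - b) ^ j) has_sum (case (x, y) of (k, \<alpha>) \<Rightarrow> \<alpha> * A k + B k)) UNIV"
    unfolding p prod.case using c(1) d(1) by (intro exI[of _ C] exI[of _ "min e1 e2"]) simp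
qed

definition complex_bessel_J :: "real \<Rightarrow> complex \<Rightarrow> complex" where
  "complex_bessel_J \<mu> z = (z / 2) powr of_real \<mu> * bessel_E \<mu> ((z / 2)\<^sup>2)"

lemma complex_bessel_J_of_real:
  assumes "0 \<le> \<mu>" "0 < x"
  shows "complex_bessel_J \<mu> (of_real x) = of_real (bessel_J \<mu> x)"
proof -
  have "(complex_of_real x / 2) powr of_real \<mu> = of_real ((x / 2) powr \<mu>)"
    using powr_of_real[of "x / 2" \<mu>] assms by simp
  moreover have "bessel_E \<mu> ((complex_of_real x / 2)\<^sup>2) = of_real (bessel_E \<mu> ((x / 2)\<^sup>2))"
    using bessel_E_of_real[OF assms(1), of "(x / 2)\<^sup>2", where 'a = complex] by simp
  ultimately show ?thesis
    using assms by (simp add: complex_bessel_J_def bessel_J_eq_bessel_E)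
qed

lemma holomorphic_on_complex_bessel_J [holomorphic_intros]:
  assumes "0 \<le> \<mu>" "g holomorphic_on A" "\<And>z. z \<in> A \<Longrightarrow> g z \<notin> \<real>\<^sub>\<le>\<^sub>0"
  shows "(\<lambda>z. complex_bessel_J \<mu> (g z)) holomorphic_on A"
proof -
  have "g z / 2 \<notin> \<real>\<^sub>\<le>\<^sub>0" if "z \<in> A" for z
    using assms(3)[OF that] by (auto simp: complex_nonpos_Reals_iff)
  then show ?thesis
    unfolding complex_bessel_J_def using assms by (intro holomorphic_intros) auto
qed

lemma real_analytic2_on_robin_det:
  assumes "0 \<le> \<mu>" "0 < R"
  shows "real_analytic2_on (\<lambda>(k, \<alpha>). robin_det l \<mu> R k \<alpha>) ({0<..} \<times> V)"
proof -
  \<comment> \<open>The ball of radius a about a > 0 lies in the right half-plane, away from the cut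
    of the complex power.\<close>
  have ball: "z * of_real R \<notin> \<real>\<^sub>\<le>\<^sub>0" if "z \<in> ball (of_real a) a" for z :: complex and a
  proof -
    have "\<bar>a - Re z\<bar> < a"
      using that abs_Re_le_cmod[of "of_real a - z"] by (simp add: dist_norm)
    then have "0 < Re z" by linarith
    then show ?thesis using assms(2) by (auto simp: complex_nonpos_Reals_iff mult_le_0_iff)
  qed
  have A: "real_analytic_on (\<lambda>k. bessel_J \<mu> (k * R)) {0<..}"
  proof (rule real_analytic_onI_holomorphic)
    fix a :: real assume "a \<in> {0<..}"
    moreover have "(\<lambda>z. complex_bessel_J \<mu> (z * of_real R)) holomorphic_on ball (of_real a) a"
      using assms ball by (intro holomorphic_intros) auto
    moreover have "complex_bessel_J \<mu> (of_real x * of_real R) = of_real (bessel_J \<mu> (x * R))"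
      if "\<bar>x - a\<bar> < a" for x
      using complex_bessel_J_of_real[of \<mu> "x * R"] assms that by simp
    ultimately show "\<exists>e>0. \<exists>F. F holomorphic_on ball (of_real a) e \<and>
        (\<forall>x. \<bar>x - a\<bar> < e \<longrightarrow> F (of_real x) = complex_of_real (bessel_J \<mu> (x * R)))"
      by (intro exI[of _ a] conjI exI[of _ "\<lambda>z. complex_bessel_J \<mu> (z * of_real R)"]) auto
  qed
  have B: "real_analytic_on (\<lambda>k. real l / R * bessel_J \<mu> (k * R) - k * bessel_J (\<mu> + 1) (k * R)) {0<..}"
  proof (rule real_analytic_onI_holomorphic)
    fix a :: real assume "a \<in> {0<..}"
    let ?F = "\<lambda>z. of_real (real l / R) * complex_bessel_J \<mu> (z * of_real R)
      - z * complex_bessel_J (\<mu> + 1) (z * of_real R)"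
    have "?F holomorphic_on ball (of_real a) a"
      using assms ball by (intro holomorphic_intros) auto
    moreover have "?F (of_real x) = of_real (real l / R * bessel_J \<mu> (x * R) - x * bessel_J (\<mu> + 1) (x * R))"
      if "\<bar>x - a\<bar> < a" for x
      using complex_bessel_J_of_real[of \<mu> "x * R"] complex_bessel_J_of_real[of "\<mu> + 1" "x * R"] assms that
      by simp
    ultimately show "\<exists>e>0. \<exists>F. F holomorphic_on ball (of_real a) e \<and>
        (\<forall>x. \<bar>x - a\<bar> < e \<longrightarrow> F (of_real x) =
          complex_of_real (real l / R * bessel_J \<mu> (x * R) - x * bessel_J (\<mu> + 1) (x * R)))"
      using \<open>a \<in> {0<..}\<close> by (intro exI[of _ a] conjI exI[of _ ?F]) auto
  qed
  have "(\<lambda>(k, \<alpha>). robin_det l \<mu> R k \<alpha>)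
      = (\<lambda>(k, \<alpha>). \<alpha> * bessel_J \<mu> (k * R) + (real l / R * bessel_J \<mu> (k * R) - k * bessel_J (\<mu> + 1) (k * R)))"
    by (simp add: fun_eq_iff robin_det_def algebra_simps)
  then show ?thesis using real_analytic2_on_affine[OF A B] by simp
qed

section \<open>Continuity and analyticity of the branches\<close>

lemma robin_root_facts:
  fixes l n :: nat
  assumes "0 \<le> \<mu>" "0 < R" "0 < \<alpha>"
  defines "k \<equiv> robin_root l \<mu> R (Suc n) \<alpha>"
  shows "0 < k" "(k * R / 2)\<^sup>2 = robin_zero \<mu> n (\<alpha> * R + real l)"
    "bessel_E \<mu> ((k * R / 2)\<^sup>2) \<noteq> 0" "bessel_h \<mu> ((k * R / 2)\<^sup>2) = \<alpha> * R + real l"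
proof -
  have v: "0 < \<alpha> * R + real l \<or> 0 < n" using assms by (simp add: add_pos_nonneg)
  have k: "k = 2 * sqrt (robin_zero \<mu> n (\<alpha> * R + real l)) / R"
    unfolding k_def using robin_root_eq[OF assms(1-3)] by simp
  have pos: "0 < robin_zero \<mu> n (\<alpha> * R + real l)" using robin_zero_pos[OF assms(1) v] .
  show "0 < k" using k pos assms(2) by simp
  show z: "(k * R / 2)\<^sup>2 = robin_zero \<mu> n (\<alpha> * R + real l)" using k pos assms(2) by simp
  show "bessel_E \<mu> ((k * R / 2)\<^sup>2) \<noteq> 0" "bessel_h \<mu> ((k * R / 2)\<^sup>2) = \<alpha> * R + real l"
    unfolding z using robin_zero[OF assms(1) v] bessel_E_nonzero_between[OF assms(1)] by auto
qed

lemma isCont_robin_root: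
  assumes "0 \<le> \<mu>" "0 < R" "0 < \<alpha>"
  shows "isCont (robin_root l \<mu> R (Suc n)) \<alpha>"
proof -
  have "isCont (robin_zero \<mu> n) (\<alpha> * R + real l)"
    using assms by (intro isCont_robin_zero) (auto simp: add_pos_nonneg)
  then have "isCont (\<lambda>\<alpha>. robin_zero \<mu> n (\<alpha> * R + real l)) \<alpha>"
    by (intro isCont_o2[where f = "\<lambda>\<alpha>. \<alpha> * R + real l" and g = "robin_zero \<mu> n"]) auto
  then have "isCont (\<lambda>\<alpha>. 2 * sqrt (robin_zero \<mu> n (\<alpha> * R + real l)) / R) \<alpha>"
    using assms(2) by (intro continuous_intros) auto
  then show ?thesis
  proof (rule isCont_cong[THEN iffD1, rotated])
    show "\<forall>\<^sub>F a in nhds \<alpha>. 2 * sqrt (robin_zero \<mu> n (a * R + real l)) / R = robin_root l \<mu> R (Suc n) a"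
      using eventually_nhds_in_open[of "{0<..}" \<alpha>] assms
      by (auto elim!: eventually_mono simp: robin_root_eq)
  qed
qed

lemma real_analytic_on_robin_root:
  assumes "0 \<le> \<mu>" "0 < R"
  shows "real_analytic_on (robin_root l \<mu> R (Suc n)) {0<..}"
proof (intro real_analytic_onI_holomorphic holomorphic_local_inverse_extends)
  \<comment> \<open>The Robin equation solved for \<alpha>: each branch is a local inverse of H. Its
    derivative at the root is nonzero by the chain rule, because Q is positive at the real
    point.\<close>
  define H where "H k = (bessel_h \<mu> ((k * of_real R / 2)\<^sup>2) - of_nat l) / of_real R" for k :: complex
  let ?S = "{k::complex. bessel_E \<mu> ((k * of_real R / 2)\<^sup>2) \<noteq> 0}"
  fix a :: real assume "a \<in> {0<..}"
  then have a: "0 < a" by simp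
  define k where "k = robin_root l \<mu> R (Suc n) a"
  note facts = robin_root_facts[OF assms, of _ l n]
  have z: "(complex_of_real k * of_real R / 2)\<^sup>2 = of_real ((k * R / 2)\<^sup>2)" for k by simp
  show "open ?S"
    using assms by (intro open_Collect_neq continuous_intros) auto
  show "H holomorphic_on ?S"
    unfolding H_def bessel_h_def using assms by (intro holomorphic_intros) auto
  show "of_real (robin_root l \<mu> R (Suc n) a) \<in> ?S"
    using facts(3)[OF a] unfolding mem_Collect_eq z bessel_E_of_real[OF assms(1)] by simp
  have eq: "H (of_real (robin_root l \<mu> R (Suc n) x)) = of_real x" if "0 < x" for x
    using facts(4)[OF that] assms(2) unfolding H_def z bessel_h_of_real[OF assms(1)] by simp
  show "\<forall>\<^sub>F x in nhds a. H (of_real (robin_root l \<mu> R (Suc n) x)) = of_real x"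
    using eventually_nhds_in_open[of "{0<..}" a] a eq by (auto elim!: eventually_mono)
  show "isCont (robin_root l \<mu> R (Suc n)) a" by (rule isCont_robin_root[OF assms a])
  let ?z = "(k * R / 2)\<^sup>2"
  have k: "0 < k" "bessel_E \<mu> ?z \<noteq> 0" using facts[OF a] by (auto simp: k_def)
  have "(bessel_h \<mu> has_field_derivative 2 * bessel_Q \<mu> (complex_of_real ?z) / (bessel_E \<mu> (of_real ?z))\<^sup>2)
      (at (of_real ?z))"
    using k by (intro DERIV_bessel_h assms) (simp add: bessel_E_of_real[OF assms(1)] del: of_real_power)
  then have "(bessel_h \<mu> has_field_derivative of_real (2 * bessel_Q \<mu> ?z / (bessel_E \<mu> ?z)\<^sup>2))
      (at ((complex_of_real k * of_real R / 2)\<^sup>2))"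
    unfolding z bessel_E_of_real[OF assms(1)] bessel_Q_of_real[OF assms(1)] by simp
  moreover have "((\<lambda>k. (k * of_real R / 2)\<^sup>2) has_field_derivative of_real k * (of_real R)\<^sup>2 / 2) (at (complex_of_real k))"
    by (auto intro!: derivative_eq_intros simp: power2_eq_square)
  ultimately have "((\<lambda>k. bessel_h \<mu> ((k * of_real R / 2)\<^sup>2)) has_field_derivative
      of_real (2 * bessel_Q \<mu> ?z / (bessel_E \<mu> ?z)\<^sup>2) * (of_real k * (of_real R)\<^sup>2 / 2)) (at (complex_of_real k))"
    by (rule DERIV_chain2)
  from DERIV_cdivide[OF DERIV_diff[OF this DERIV_const]]
  have "deriv H (of_real k) = (of_real (2 * bessel_Q \<mu> ?z / (bessel_E \<mu> ?z)\<^sup>2) * (of_real k * (of_real R)\<^sup>2 / 2) - 0) / of_real R"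
    unfolding H_def[abs_def] by (rule DERIV_imp_deriv)
  moreover have "0 < bessel_Q \<mu> ?z" using k assms by (intro bessel_Q_pos) auto
  ultimately show "deriv H (of_real (robin_root l \<mu> R (Suc n) a)) \<noteq> 0"
    using k assms unfolding k_def[symmetric] by simp
qed

section \<open>Radial eigenfunctions\<close>

lemma at_within_Ioc_eq_at_left:
  assumes "a < (b::real)"
  shows "at b within {a<..b} = at_left b"
  by (rule at_within_nhd[of b "{a<..}"]) (use assms in auto)

text \<open>L'Hospital's rule for the difference quotient at b. It ties a one-sided derivative to
  interior derivatives without assuming that the derivative is continuous at b.\<close>

lemma left_deriv_eq_limit:
  fixes f f' :: "real \<Rightarrow> real"
  assumes D: "(f has_real_derivative D) (at b within {..<b})"
    and f': "\<forall>\<^sub>F x in at_left b. (f has_real_derivative f' x) (at x)" "(f' \<longlongrightarrow> L) (at_left b)"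
  shows "D = L"
proof -
  have "((\<lambda>x. (f x - f b) / (x - b)) \<longlongrightarrow> L) (at_left b)"
  proof (rule lhopital_left)
    have "(f \<longlongrightarrow> f b) (at_left b)"
      using DERIV_continuous[OF D] by (simp add: continuous_within)
    then show "((\<lambda>x. f x - f b) \<longlongrightarrow> 0) (at_left b)" by (simp add: LIM_zero_iff)
    show "((\<lambda>x. x - b) \<longlongrightarrow> 0) (at_left b)" by (auto intro!: tendsto_eq_intros)
    show "\<forall>\<^sub>F x in at_left b. x - b \<noteq> 0"
      by (auto simp: eventually_at_filter)
    show "\<forall>\<^sub>F x in at_left b. ((\<lambda>x. f x - f b) has_real_derivative f' x) (at x)"
      using f'(1) by eventually_elim (auto intro!: derivative_eq_intros)
    show "\<forall>\<^sub>F x in at_left b. ((\<lambda>x. x - b) has_real_derivative 1) (at x)"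
      by (auto intro!: always_eventually derivative_eq_intros)
  qed (use f'(2) in auto)
  moreover have "((\<lambda>x. (f x - f b) / (x - b)) \<longlongrightarrow> D) (at_left b)"
    using D by (simp add: has_field_derivative_iff)
  ultimately show ?thesis
    using tendsto_unique[OF trivial_limit_at_left_real] by blast
qed

text \<open>The Wronskian of two solutions is a constant multiple of \<open>r powr - n\<close>. It vanishes because both
  solutions satisfy the same condition at \<open>R\<close>; as \<open>u'\<close> need not be continuous there, this is read off
  the one-sided derivative of the quotient \<open>u / v\<close>.\<close>

lemma radial_wronskian_zero:
  fixes u v u' v' q :: "real \<Rightarrow> real" and n R :: real
  assumes R: "0 < R"
    and u: "\<And>r. r \<in> {0<..R} \<Longrightarrow> (u has_real_derivative u' r) (at r within {0<..R})"
      "\<And>r. r \<in> {0<..<R} \<Longrightarrow> (u' has_real_derivative - (n / r) * u' r - q r * u r) (at r)"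
    and v: "\<And>r. r \<in> {0<..R} \<Longrightarrow> (v has_real_derivative v' r) (at r within {0<..R})"
      "\<And>r. r \<in> {0<..<R} \<Longrightarrow> (v' has_real_derivative - (n / r) * v' r - q r * v r) (at r)"
    and bc: "v R \<noteq> 0" "u' R * v R = u R * v' R"
    and r: "r \<in> {0<..<R}"
  shows "u' r * v r = u r * v' r"
proof -
  have int: "at r within {0<..R} = at r" if "r \<in> {0<..<R}" for r
    by (rule at_within_open_subset[of r "{0<..<R}"]) (use that in auto)
  have DR: "(u has_real_derivative u' R) (at_left R)" "(v has_real_derivative v' R) (at_left R)"
    using u(1)[of R] v(1)[of R] R by (simp_all add: at_within_Ioc_eq_at_left)
  let ?w = "\<lambda>r. r powr n * (u' r * v r - u r * v' r)"
  have "(?w has_real_derivative 0) (at r within {0<..<R})" if r: "r \<in> {0<..<R}" for r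
  proof -
    have "(u has_real_derivative u' r) (at r)" "(v has_real_derivative v' r) (at r)"
      using u(1)[of r] v(1)[of r] int[OF r] r by auto
    then have "(?w has_real_derivative
        n * r powr (n - 1) * (u' r * v r - u r * v' r)
        + r powr n * ((- (n / r) * u' r - q r * u r) * v r + u' r * v' r
          - (u' r * v' r + u r * (- (n / r) * v' r - q r * v r)))) (at r)"
      using u(2)[OF r] v(2)[OF r] r
      by (auto intro!: derivative_eq_intros simp: algebra_simps)
    also have "n * r powr (n - 1) * (u' r * v r - u r * v' r)
        + r powr n * ((- (n / r) * u' r - q r * u r) * v r + u' r * v' r
          - (u' r * v' r + u r * (- (n / r) * v' r - q r * v r))) = 0"
      using r by (simp add: powr_diff field_simps)
    finally show ?thesis by (rule has_field_derivative_at_within)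
  qed
  then obtain C where C: "\<And>r. r \<in> {0<..<R} \<Longrightarrow> ?w r = C"
    using has_field_derivative_zero_constant[of "{0<..<R}" ?w] by auto
  let ?q = "\<lambda>r. u r / v r" and ?q' = "\<lambda>r. C / r powr n / (v r)\<^sup>2"
  have cont: "(v \<longlongrightarrow> v R) (at_left R)"
    using DERIV_continuous[OF DR(2)] by (simp add: continuous_within)
  \<comment> \<open>By the common boundary condition this derivative is 0, whereas the interior
    derivatives tend to a nonzero multiple of C; hence C = 0.\<close>
  have "(?q has_real_derivative (u' R * v R - u R * v' R) / (v R * v R)) (at_left R)"
    using DR bc by (auto intro!: derivative_eq_intros)
  moreover have "\<forall>\<^sub>F r in at_left R. (?q has_real_derivative ?q' r) (at r)"
    using eventually_at_left_real[OF R] tendsto_imp_eventually_ne[OF cont bc(1)]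
  proof eventually_elim
    case (elim r)
    then have "(u has_real_derivative u' r) (at r)" "(v has_real_derivative v' r) (at r)"
      using u(1)[of r] v(1)[of r] int[of r] by auto
    then have "(?q has_real_derivative (u' r * v r - u r * v' r) / (v r * v r)) (at r)"
      using elim by (auto intro!: derivative_eq_intros)
    moreover have "u' r * v r - u r * v' r = C / r powr n"
      using C[OF elim(1)] elim by (simp add: field_simps)
    ultimately show ?case by (simp add: power2_eq_square)
  qed
  moreover have "(?q' \<longlongrightarrow> C / R powr n / (v R)\<^sup>2) (at_left R)"
    using R bc(1) by (intro tendsto_intros cont) auto
  ultimately have "(u' R * v R - u R * v' R) / (v R * v R) = C / R powr n / (v R)\<^sup>2"
    by (rule left_deriv_eq_limit)
  then have "C = 0" using bc R by simp
  then show ?thesis using C[OF r] r by auto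
qed

text \<open>Solutions with vanishing Wronskian are proportional also across zeros of \<open>v\<close>: the factor is
  written with the nonvanishing denominator \<open>v\<^sup>2 + v'\<^sup>2\<close>.\<close>

lemma radial_solutions_proportional:
  fixes u v u' v' q :: "real \<Rightarrow> real" and n R :: real
  assumes R: "0 < R"
    and u: "\<And>r. r \<in> {0<..R} \<Longrightarrow> (u has_real_derivative u' r) (at r within {0<..R})"
      "\<And>r. r \<in> {0<..<R} \<Longrightarrow> (u' has_real_derivative - (n / r) * u' r - q r * u r) (at r)"
    and v: "\<And>r. r \<in> {0<..R} \<Longrightarrow> (v has_real_derivative v' r) (at r within {0<..R})"
      "\<And>r. r \<in> {0<..<R} \<Longrightarrow> (v' has_real_derivative - (n / r) * v' r - q r * v r) (at r)"
    and bc: "v R \<noteq> 0" "u' R * v R = u R * v' R"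
    and nz: "\<And>r. r \<in> {0<..<R} \<Longrightarrow> v r \<noteq> 0 \<or> v' r \<noteq> 0"
  shows "\<exists>c. \<forall>r\<in>{0<..R}. u r = c * v r"
proof -
  have int: "at r within {0<..R} = at r" if "r \<in> {0<..<R}" for r
    by (rule at_within_open_subset[of r "{0<..<R}"]) (use that in auto)
  let ?N = "\<lambda>r. v r * v r + v' r * v' r"
  \<comment> \<open>The coefficient of the projection of (u, u') onto (v, v'), which are parallel
    because the Wronskian vanishes.\<close>
  define k where "k r = (u r * v r + u' r * v' r) / ?N r" for r
  have N: "?N r \<noteq> 0" if "r \<in> {0<..<R}" for r
    using nz[OF that] by (simp add: sum_squares_eq_zero_iff)
  have k: "u r = k r * v r" "u' r = k r * v' r" if "r \<in> {0<..<R}" for r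
  proof -
    have "u' r * v r = u r * v' r"
      by (rule radial_wronskian_zero[OF R u v bc that])
    then have "u r * ?N r = (u r * v r + u' r * v' r) * v r" "u' r * ?N r = (u r * v r + u' r * v' r) * v' r"
      by algebra+
    then show "u r = k r * v r" "u' r = k r * v' r"
      using N[OF that] unfolding k_def by (metis nonzero_mult_div_cancel_right times_divide_eq_left)+
  qed
  have "(k has_real_derivative 0) (at r within {0<..<R})" if r: "r \<in> {0<..<R}" for r
  proof -
    define U V where "U = - (n / r) * u' r - q r * u r" and "V = - (n / r) * v' r - q r * v r"
    \<comment> \<open>\<open>U\<close> and \<open>V\<close> are the second derivatives; the common
      linear equation gives them the same factor, so the numerator of k' cancels.\<close>
    have U: "U = k r * V" unfolding U_def V_def k[OF r] by (simp add: algebra_simps)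
    have "(u has_real_derivative u' r) (at r)" "(v has_real_derivative v' r) (at r)"
      using u(1)[of r] v(1)[of r] int[OF r] r by auto
    then have "(k has_real_derivative
        ((u' r * v r + u r * v' r + (U * v' r + u' r * V)) * ?N r
          - (u r * v r + u' r * v' r) * (2 * v r * v' r + 2 * v' r * V)) / (?N r * ?N r)) (at r)"
      unfolding k_def[abs_def] using u(2)[OF r, folded U_def] v(2)[OF r, folded V_def] N[OF r]
      by (auto intro!: derivative_eq_intros simp: algebra_simps)
    also have "(u' r * v r + u r * v' r + (U * v' r + u' r * V)) * ?N r
          - (u r * v r + u' r * v' r) * (2 * v r * v' r + 2 * v' r * V) = 0"
      unfolding U k[OF r] by (simp add: algebra_simps)
    finally show ?thesis by (simp add: has_field_derivative_at_within)
  qed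
  then obtain c where c: "\<And>r. r \<in> {0<..<R} \<Longrightarrow> k r = c"
    using has_field_derivative_zero_constant[of "{0<..<R}" k] by auto
  have "u r = c * v r" if r: "r \<in> {0<..R}" for r
  proof (cases "r = R")
    case True
    have lim: "(u \<longlongrightarrow> u R) (at_left R)" "(v \<longlongrightarrow> v R) (at_left R)"
      using DERIV_continuous[OF u(1)[of R]] DERIV_continuous[OF v(1)[of R]] R
      by (simp_all add: continuous_within at_within_Ioc_eq_at_left)
    have "((\<lambda>r. c * v r) \<longlongrightarrow> c * v R) (at_left R)" by (intro tendsto_intros lim)
    moreover have "\<forall>\<^sub>F r in at_left R. c * v r = u r"
      using eventually_at_left_real[OF R] by eventually_elim (use k(1) c in auto)
    ultimately have "(u \<longlongrightarrow> c * v R) (at_left R)" using tendsto_cong by fast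
    then show ?thesis
      using tendsto_unique[OF trivial_limit_at_left_real lim(1)] True by simp
  qed (use k(1) c r in auto)
  then show ?thesis by blast
qed

text \<open>For positive k and r, and with \<mu> = l + \<nu>, a constant multiple of r^(-\<nu>) J(k
  r) with J of order \<mu>, normalised so that it extends smoothly to r = 0.\<close>

definition radial_bessel :: "nat \<Rightarrow> real \<Rightarrow> real \<Rightarrow> real \<Rightarrow> real" where
  "radial_bessel l \<mu> k r = r ^ l * bessel_E \<mu> ((k * r / 2)\<^sup>2)"

text \<open>\<open>r ^ l / r\<close> stands for r^(l-1), which a natural exponent does not express
  at \<open>l = 0\<close>.\<close>

definition radial_bessel' :: "nat \<Rightarrow> real \<Rightarrow> real \<Rightarrow> real \<Rightarrow> real" where
  "radial_bessel' l \<mu> k r = r ^ l / r *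
     (real l * bessel_E \<mu> ((k * r / 2)\<^sup>2) - 2 * (k * r / 2)\<^sup>2 * bessel_E (\<mu> + 1) ((k * r / 2)\<^sup>2))"

lemma DERIV_power_div:
  fixes r :: real
  assumes "r \<noteq> 0"
  shows "((\<lambda>r. r ^ l) has_real_derivative real l * (r ^ l / r)) (at r)"
  using assms by (intro DERIV_cong[OF DERIV_pow]) (cases l; simp)

lemma DERIV_radial_bessel:
  assumes "0 \<le> \<mu>" "0 < r"
  shows "(radial_bessel l \<mu> k has_real_derivative radial_bessel' l \<mu> k r) (at r)"
proof -
  let ?z = "(k * r / 2)\<^sup>2"
  have "((\<lambda>r. bessel_E \<mu> ((k * r / 2)\<^sup>2)) has_real_derivative - bessel_E (\<mu> + 1) ?z * (k\<^sup>2 * r / 2)) (at r)"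
    using assms by (auto intro!: derivative_eq_intros simp: power2_eq_square)
  from DERIV_mult[OF DERIV_power_div this, of l] assms(2)
  have "(radial_bessel l \<mu> k has_real_derivative
      real l * (r ^ l / r) * bessel_E \<mu> ?z + - bessel_E (\<mu> + 1) ?z * (k\<^sup>2 * r / 2) * r ^ l) (at r)"
    unfolding radial_bessel_def[abs_def] by simp
  also have "real l * (r ^ l / r) * bessel_E \<mu> ?z + - bessel_E (\<mu> + 1) ?z * (k\<^sup>2 * r / 2) * r ^ l
      = radial_bessel' l \<mu> k r"
    unfolding radial_bessel'_def using assms(2) by (simp add: field_simps power2_eq_square)
  finally show ?thesis .
qed

text \<open>In the variable z the radial equation is the recurrence \<open>bessel_E_rec\<close>; d
  is expressed through \<mu> and l, and k^2 through z, so that only this identity remains.\<close>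

lemma DERIV_radial_bessel':
  assumes "0 \<le> \<mu>" "0 < r" and d: "\<mu> = real l + (real d / 2 - 1)"
  shows "(radial_bessel' l \<mu> k has_real_derivative
    - ((real d - 1) / r) * radial_bessel' l \<mu> k r
    - (k\<^sup>2 - real l * (real l + real d - 2) / r\<^sup>2) * radial_bessel l \<mu> k r) (at r)"
proof -
  have d': "real d = 2 * (\<mu> - real l + 1)" using d by simp
  define z where "z = (k * r / 2)\<^sup>2"
  let ?e = "bessel_E \<mu> z" and ?f = "bessel_E (\<mu> + 1) z" and ?g = "bessel_E (\<mu> + 2) z"
  have g: "z * ?g = (\<mu> + 1) * ?f - ?e"
    using bessel_E_rec[OF assms(1), of z] by simp
  have kz: "k\<^sup>2 = 4 * z / r\<^sup>2" using assms(2) by (simp add: z_def power_mult_distrib power_divide)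
  have 1: "((\<lambda>r. (k * r / 2)\<^sup>2) has_real_derivative 2 * z / r) (at r)"
    using assms(2) by (auto intro!: derivative_eq_intros simp: power2_eq_square z_def)
  have ef: "((\<lambda>r. bessel_E \<mu> ((k * r / 2)\<^sup>2)) has_real_derivative - ?f * (2 * z / r)) (at r)"
    "((\<lambda>r. bessel_E (\<mu> + 1) ((k * r / 2)\<^sup>2)) has_real_derivative - ?g * (2 * z / r)) (at r)"
    using DERIV_bessel_E'[OF _ 1, of \<mu>] DERIV_bessel_E'[OF _ 1, of "\<mu> + 1"] assms(1) by (simp_all add: add_ac flip: z_def)
  have "((\<lambda>r. real l * bessel_E \<mu> ((k * r / 2)\<^sup>2) - 2 * (k * r / 2)\<^sup>2 * bessel_E (\<mu> + 1) ((k * r / 2)\<^sup>2))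
      has_real_derivative (real l * (- ?f) - (2 * ?f + 2 * z * (- ?g))) * (2 * z / r)) (at r)"
    by (rule DERIV_cong[OF DERIV_diff[OF DERIV_cmult[OF ef(1)] DERIV_mult[OF DERIV_cmult[OF 1] ef(2)]]])
      (simp add: algebra_simps flip: z_def)
  moreover have "((\<lambda>r. r ^ l / r) has_real_derivative (real l - 1) * (r ^ l / r\<^sup>2)) (at r)"
    using DERIV_divide[OF DERIV_power_div[of r l] DERIV_ident] assms(2)
    by (simp add: field_simps power2_eq_square)
  ultimately have "(radial_bessel' l \<mu> k has_real_derivative
      (real l - 1) * (r ^ l / r\<^sup>2) * (real l * ?e - 2 * z * ?f)
      + (real l * (- ?f) - (2 * ?f + 2 * z * (- ?g))) * (2 * z / r) * (r ^ l / r)) (at r)"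
    unfolding radial_bessel'_def[abs_def] z_def using DERIV_mult by blast
  also have "(real l - 1) * (r ^ l / r\<^sup>2) * (real l * ?e - 2 * z * ?f)
      + (real l * (- ?f) - (2 * ?f + 2 * z * (- ?g))) * (2 * z / r) * (r ^ l / r)
      = r ^ l / r\<^sup>2 * ((real l - 1) * (real l * ?e - 2 * z * ?f)
          + (real l * (- ?f) - 2 * ?f + 2 * (z * ?g)) * (2 * z))"
    using assms(2) by (simp add: field_simps power2_eq_square)
  also have "\<dots> = - ((real d - 1) / r) * (r ^ l / r * (real l * ?e - 2 * z * ?f))
      - (4 * z / r\<^sup>2 - real l * (real l + real d - 2) / r\<^sup>2) * (r ^ l * ?e)"
    unfolding g d' using assms(2) by (simp add: field_simps power2_eq_square)
  finally show ?thesis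
    unfolding radial_bessel'_def radial_bessel_def z_def[symmetric] kz[symmetric] .
qed

text \<open>A common zero would make E vanish together with the E of order \<mu> + 1, against the
  simplicity of the zeros.\<close>

lemma radial_bessel_nonzero:
  assumes "0 \<le> \<mu>" "0 < r" "0 < k"
  shows "radial_bessel l \<mu> k r \<noteq> 0 \<or> radial_bessel' l \<mu> k r \<noteq> 0"
  using bessel_E_Suc_nonzero[OF assms(1), of "(k * r / 2)\<^sup>2"] assms
  by (auto simp: radial_bessel_def radial_bessel'_def)

text \<open>At R the logarithmic derivative satisfies R u' / u = l - h(z), so the Robin condition is
  h(z) = \<alpha> R + l.\<close>

lemma radial_eigenfunction_radial_bessel:
  assumes "0 \<le> \<mu>" "0 < R" and d: "\<mu> = real l + (real d / 2 - 1)"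
    and e: "bessel_E \<mu> ((k * R / 2)\<^sup>2) \<noteq> 0" and h: "bessel_h \<mu> ((k * R / 2)\<^sup>2) = \<alpha> * R + real l"
  shows "radial_eigenfunction d l R \<alpha> (k\<^sup>2) (radial_bessel l \<mu> k)"
    and "radial_bessel' l \<mu> k R + \<alpha> * radial_bessel l \<mu> k R = 0"
proof -
  show bc: "radial_bessel' l \<mu> k R + \<alpha> * radial_bessel l \<mu> k R = 0"
    using e h assms(2) by (simp add: radial_bessel'_def radial_bessel_def bessel_h_def field_simps)
  let ?u'' = "\<lambda>r. - ((real d - 1) / r) * radial_bessel' l \<mu> k r
    - (k\<^sup>2 - real l * (real l + real d - 2) / r\<^sup>2) * radial_bessel l \<mu> k r"
  have "continuous_on UNIV (radial_bessel l \<mu> k)"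
    unfolding radial_bessel_def[abs_def] using assms(1) by (intro continuous_intros) auto
  then have "(radial_bessel l \<mu> k \<longlongrightarrow> radial_bessel l \<mu> k 0) (at_right 0)"
    by (simp add: continuous_on_eq_continuous_at isCont_def filterlim_at_split)
  then have "\<forall>\<^sub>F r in at_right 0. dist (radial_bessel l \<mu> k r) (radial_bessel l \<mu> k 0) < 1"
    by (rule tendstoD) simp
  then have "Bfun (radial_bessel l \<mu> k) (at_right 0)"
    unfolding Bfun_metric_def by (intro exI[of _ "radial_bessel l \<mu> k 0"] exI[of _ 1]) (auto elim: eventually_mono)
  moreover have "radial_bessel l \<mu> k R \<noteq> 0" using e assms(2) by (simp add: radial_bessel_def)
  ultimately show "radial_eigenfunction d l R \<alpha> (k\<^sup>2) (radial_bessel l \<mu> k)"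
    unfolding radial_eigenfunction_def
    using DERIV_radial_bessel[OF assms(1)] DERIV_radial_bessel'[OF assms(1) _ d] bc assms(2)
    by (intro conjI exI[of _ "radial_bessel' l \<mu> k"] exI[of _ ?u''])
      (auto intro: has_field_derivative_at_within)
qed

lemma radial_eigenfunction_multiple:
  assumes "0 \<le> \<mu>" "0 < R" "0 < k" and d: "\<mu> = real l + (real d / 2 - 1)"
    and e: "bessel_E \<mu> ((k * R / 2)\<^sup>2) \<noteq> 0" and h: "bessel_h \<mu> ((k * R / 2)\<^sup>2) = \<alpha> * R + real l"
    and u: "radial_eigenfunction d l R \<alpha> (k\<^sup>2) u"
  shows "\<exists>c. \<forall>r\<in>{0<..R}. u r = c * radial_bessel l \<mu> k r"
proof -
  obtain u' u'' where u:
    "\<And>r. r \<in> {0<..R} \<Longrightarrow> (u has_real_derivative u' r) (at r within {0<..R})"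
    "\<And>r. r \<in> {0<..<R} \<Longrightarrow> (u' has_real_derivative u'' r) (at r)"
    "\<And>r. r \<in> {0<..<R} \<Longrightarrow> u'' r + (real d - 1) / r * u' r
       + (k\<^sup>2 - real l * (real l + real d - 2) / r\<^sup>2) * u r = 0"
    "u' R + \<alpha> * u R = 0"
    using u unfolding radial_eigenfunction_def by blast
  let ?q = "\<lambda>r. k\<^sup>2 - real l * (real l + real d - 2) / r\<^sup>2"
  have ode: "(u' has_real_derivative - ((real d - 1) / r) * u' r - ?q r * u r) (at r)" if "r \<in> {0<..<R}" for r
  proof (rule DERIV_cong[OF u(2)[OF that]])
    show "u'' r = - ((real d - 1) / r) * u' r - ?q r * u r" using u(3)[OF that] by linarith
  qed
  have bc: "radial_bessel' l \<mu> k R = - \<alpha> * radial_bessel l \<mu> k R" "u' R = - \<alpha> * u R"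
    using radial_eigenfunction_radial_bessel(2)[OF assms(1,2) d e h] u(4) by linarith+
  show ?thesis
  proof (rule radial_solutions_proportional[OF assms(2) u(1) ode])
    show "radial_bessel l \<mu> k R \<noteq> 0" using e assms(2) by (simp add: radial_bessel_def)
    show "u' R * radial_bessel l \<mu> k R = u R * radial_bessel' l \<mu> k R" unfolding bc by simp
  qed (use DERIV_radial_bessel[OF assms(1)] DERIV_radial_bessel'[OF assms(1) _ d]
      radial_bessel_nonzero[OF assms(1) _ assms(3)] in \<open>auto intro: has_field_derivative_at_within\<close>)
qed

lemma radial_eigenfunction_unique:
  assumes "0 \<le> \<mu>" "0 < R" "0 < k" and d: "\<mu> = real l + (real d / 2 - 1)"
    and e: "bessel_E \<mu> ((k * R / 2)\<^sup>2) \<noteq> 0" and h: "bessel_h \<mu> ((k * R / 2)\<^sup>2) = \<alpha> * R + real l"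
    and u: "radial_eigenfunction d l R \<alpha> (k\<^sup>2) u" and v: "radial_eigenfunction d l R \<alpha> (k\<^sup>2) v"
  shows "\<exists>c. \<forall>r\<in>{0<..R}. v r = c * u r"
proof -
  obtain a b where a: "\<And>r. r \<in> {0<..R} \<Longrightarrow> u r = a * radial_bessel l \<mu> k r"
    and b: "\<And>r. r \<in> {0<..R} \<Longrightarrow> v r = b * radial_bessel l \<mu> k r"
    using radial_eigenfunction_multiple[OF assms(1-6)] u v by metis
  \<comment> \<open>Here the nontriviality of an eigenfunction enters; it allows division by the
    factor of u.\<close>
  moreover have "a \<noteq> 0" using u a unfolding radial_eigenfunction_def by auto
  ultimately show ?thesis by (intro exI[of _ "b / a"]) auto
qed

section \<open>Limits and bounds\<close>

lemma filterlim_robin_root: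
  assumes "0 \<le> \<mu>" "0 < R" "0 < \<alpha>"
  shows "filterlim (\<lambda>p. robin_root l \<mu> R p \<alpha>) at_top sequentially"
\<comment> \<open>The shift aligns root n + 1 with the left end of its interval, zero number n,
  which tends to infinity.\<close>
proof (subst filterlim_sequentially_Suc[symmetric], rule filterlim_at_top_mono)
  have "filterlim (\<lambda>n. sqrt (bessel_zero \<mu> n)) at_top sequentially"
    by (rule filterlim_compose[OF sqrt_at_top bessel_zero(4)[OF assms(1)]])
  then show "filterlim (\<lambda>n. (2 / R) * sqrt (bessel_zero \<mu> n)) at_top sequentially"
    using assms(2) by (intro filterlim_tendsto_pos_mult_at_top[OF tendsto_const]) auto
  have "(2 / R) * sqrt (bessel_zero \<mu> n) \<le> robin_root l \<mu> R (Suc n) \<alpha>" for n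
    using robin_zero(1)[OF assms(1), of "\<alpha> * R + real l" n] robin_root_eq(2)[OF assms, of l n] assms
    by (simp add: add_pos_nonneg divide_right_mono)
  then show "\<forall>\<^sub>F n in sequentially. (2 / R) * sqrt (bessel_zero \<mu> n) \<le> robin_root l \<mu> R (Suc n) \<alpha>"
    by simp
qed

lemma robin_root_less_dirichlet_root:
  assumes "0 \<le> \<mu>" "0 < R" "0 < \<alpha>"
  shows "robin_root l \<mu> R (Suc n) \<alpha> < dirichlet_root \<mu> (Suc n) / R"
  using robin_zero(2)[OF assms(1), of "\<alpha> * R + real l" n] assms
  by (simp add: robin_root_eq(2) dirichlet_root_eq(2) add_pos_nonneg divide_strict_right_mono)

lemma neumann_root_less_robin_root:
  assumes "0 \<le> \<mu>" "0 < R" "0 < \<alpha>"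
  shows "neumann_root l \<mu> (Suc n) / R < robin_root l \<mu> R (Suc n) \<alpha>"
\<comment> \<open>Here the Neumann value is 0 by definition rather than a value of the branch, and
  positivity of the Robin root is enough.\<close>
proof (cases "l = 0 \<and> n = 0")
  case True
  then show ?thesis
    using robin_root_facts(1)[OF assms] neumann_root_eq[OF assms(1), of l n] by simp
next
  case False
  then have "robin_zero \<mu> n (real l) < robin_zero \<mu> n (\<alpha> * R + real l)"
    using assms by (intro robin_zero_strict_mono) auto
  then show ?thesis
    using False assms by (auto simp: robin_root_eq(2) neumann_root_eq divide_strict_right_mono)
qed

lemma robin_root_strict_mono:
  assumes "0 \<le> \<mu>" "0 < R" "0 < \<alpha>" "\<alpha> < \<beta>"
  shows "robin_root l \<mu> R (Suc n) \<alpha> < robin_root l \<mu> R (Suc n) \<beta>"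
proof -
  have "robin_zero \<mu> n (\<alpha> * R + real l) < robin_zero \<mu> n (\<beta> * R + real l)"
    using assms by (intro robin_zero_strict_mono) (auto simp: add_pos_nonneg)
  then show ?thesis using assms by (simp add: robin_root_eq(2) divide_strict_right_mono)
qed

lemma robin_root_tendsto_dirichlet_root:
  assumes "0 \<le> \<mu>" "0 < R"
  shows "(robin_root l \<mu> R (Suc n) \<longlongrightarrow> dirichlet_root \<mu> (Suc n) / R) at_top"
proof -
  have "filterlim (\<lambda>\<alpha>. real l + \<alpha> * R) at_top at_top"
    using assms(2) by (intro filterlim_tendsto_add_at_top[OF tendsto_const] filterlim_at_top_mult_tendsto_pos[OF tendsto_const])
      (auto simp: filterlim_ident)
  then have "((\<lambda>\<alpha>. robin_zero \<mu> n (real l + \<alpha> * R)) \<longlongrightarrow> bessel_zero \<mu> (Suc n)) at_top"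
    by (rule filterlim_compose[OF robin_zero_tendsto_bessel_zero[OF assms(1)]])
  then have "((\<lambda>\<alpha>. 2 * sqrt (robin_zero \<mu> n (real l + \<alpha> * R)) / R) \<longlongrightarrow> dirichlet_root \<mu> (Suc n) / R) at_top"
    unfolding dirichlet_root_eq(2)[OF assms(1)] using assms(2) by (intro tendsto_intros) auto
  moreover have "\<forall>\<^sub>F \<alpha> in at_top. 2 * sqrt (robin_zero \<mu> n (real l + \<alpha> * R)) / R = robin_root l \<mu> R (Suc n) \<alpha>"
    using eventually_gt_at_top[of 0] by eventually_elim (simp add: robin_root_eq(2)[OF assms] add_ac)
  ultimately show ?thesis by (rule Lim_transform_eventually)
qed

lemma robin_root_tendsto_neumann_root:
  assumes "0 \<le> \<mu>" "0 < R"
  shows "(robin_root l \<mu> R (Suc n) \<longlongrightarrow> neumann_root l \<mu> (Suc n) / R) (at_right 0)"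
proof -
  have "((\<lambda>\<alpha>. 2 * sqrt (robin_zero \<mu> n (\<alpha> * R + real l)) / R) \<longlongrightarrow> neumann_root l \<mu> (Suc n) / R) (at_right 0)"
  proof (cases "l = 0 \<and> n = 0")
    case True
    have "filterlim (\<lambda>\<alpha>. \<alpha> * R) (at_right 0) (at_right 0)"
      using assms(2) by (intro tendsto_imp_filterlim_at_right)
        (auto intro!: tendsto_eq_intros eventually_mono[OF eventually_at_right_less])
    then have "((\<lambda>\<alpha>. robin_zero \<mu> 0 (\<alpha> * R)) \<longlongrightarrow> 0) (at_right 0)"
      by (rule filterlim_compose[OF robin_zero_tendsto_0[OF assms(1)]])
    then have "((\<lambda>\<alpha>. 2 * sqrt (robin_zero \<mu> 0 (\<alpha> * R)) / R) \<longlongrightarrow> 2 * sqrt 0 / R) (at_right 0)"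
      using assms(2) by (intro tendsto_intros) auto
    then show ?thesis using True by (simp add: neumann_root_eq[OF assms(1)])
  next
    case False
    then have "isCont (robin_zero \<mu> n) (real l)"
      using assms(1) by (intro isCont_robin_zero) auto
    moreover have "((\<lambda>\<alpha>. \<alpha> * R + real l) \<longlongrightarrow> real l) (at_right 0)"
      by (auto intro!: tendsto_eq_intros)
    ultimately have "((\<lambda>\<alpha>. robin_zero \<mu> n (\<alpha> * R + real l)) \<longlongrightarrow> robin_zero \<mu> n (real l)) (at_right 0)"
      by (rule isCont_tendsto_compose)
    then have "((\<lambda>\<alpha>. 2 * sqrt (robin_zero \<mu> n (\<alpha> * R + real l)) / R)
        \<longlongrightarrow> 2 * sqrt (robin_zero \<mu> n (real l)) / R) (at_right 0)"
      using assms(2) by (intro tendsto_intros) auto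
    then show ?thesis using False by (auto simp: neumann_root_eq[OF assms(1)])
  qed
  moreover have "\<forall>\<^sub>F \<alpha> in at_right 0. 2 * sqrt (robin_zero \<mu> n (\<alpha> * R + real l)) / R = robin_root l \<mu> R (Suc n) \<alpha>"
    using eventually_at_right_less[of 0] by eventually_elim (simp add: robin_root_eq(2)[OF assms])
  ultimately show ?thesis by (rule Lim_transform_eventually)
qed

theorem theorem3:
  fixes d l :: nat and R \<nu> \<mu> :: real
  assumes "2 \<le> d" and "\<nu> = real d / 2 - 1" and "\<mu> = real l + \<nu>" and "0 < R"
  shows
    "(\<forall>\<alpha>>0.
        (\<forall>p\<ge>1. is_pos_root (\<lambda>k. robin_det l \<mu> R k \<alpha>) p (robin_root l \<mu> R p \<alpha>)) \<and>
        {k. 0 < k \<and> robin_det l \<mu> R k \<alpha> = 0} = (\<lambda>p. robin_root l \<mu> R p \<alpha>) ` {1..} \<and>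
        strict_mono_on {1..} (\<lambda>p. robin_root l \<mu> R p \<alpha>) \<and>
        filterlim (\<lambda>p. robin_root l \<mu> R p \<alpha>) at_top sequentially \<and>
        (\<forall>p\<ge>1.
           (\<exists>u. radial_eigenfunction d l R \<alpha> ((robin_root l \<mu> R p \<alpha>)\<^sup>2) u) \<and>
           (\<forall>u v. radial_eigenfunction d l R \<alpha> ((robin_root l \<mu> R p \<alpha>)\<^sup>2) u \<longrightarrow>
                  radial_eigenfunction d l R \<alpha> ((robin_root l \<mu> R p \<alpha>)\<^sup>2) v \<longrightarrow>
                  (\<exists>c. \<forall>r\<in>{0<..R}. v r = c * u r))))
     \<and> (real_analytic2_on (\<lambda>(k, \<alpha>). robin_det l \<mu> R k \<alpha>) ({0<..} \<times> {0<..}) \<and>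
        (\<forall>p\<ge>1. real_analytic_on (\<lambda>\<alpha>. robin_root l \<mu> R p \<alpha>) {0<..}))
     \<and> (\<forall>p\<ge>1. strict_mono_on {0<..} (\<lambda>\<alpha>. robin_root l \<mu> R p \<alpha>))
     \<and> ((\<forall>p\<ge>1. is_pos_root (neumann_fun l \<mu>) p (pos_root (neumann_fun l \<mu>) p)) \<and>
        (\<forall>p\<ge>1. is_pos_root (bessel_J \<mu>) p (dirichlet_root \<mu> p)) \<and>
        (\<forall>x>0. neumann_fun l \<mu> x = 0 \<longleftrightarrow>
               (bessel_J \<mu> has_real_derivative \<nu> / x * bessel_J \<mu> x) (at x)) \<and>
        (\<forall>p\<ge>1.
           ((\<lambda>\<alpha>. robin_root l \<mu> R p \<alpha>) \<longlongrightarrow> neumann_root l \<mu> p / R) (at_right 0) \<and>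
           ((\<lambda>\<alpha>. robin_root l \<mu> R p \<alpha>) \<longlongrightarrow> dirichlet_root \<mu> p / R) at_top \<and>
           (\<forall>\<alpha>>0. neumann_root l \<mu> p / R < robin_root l \<mu> R p \<alpha> \<and>
                  robin_root l \<mu> R p \<alpha> < dirichlet_root \<mu> p / R)))"
proof -
  have \<mu>: "0 \<le> \<mu>" and R: "0 < R" and d: "\<mu> = real l + (real d / 2 - 1)" using assms by auto
  have range_Suc: "{1..} = range Suc"
    unfolding One_nat_def atLeast_Suc_greaterThan by (rule greaterThan_0)
  have Suc: "\<exists>n. p = Suc n" if "1 \<le> p" for p using that by (cases p) auto
  show ?thesis
  proof (intro conjI allI impI)
    fix \<alpha> :: real assume \<alpha>: "0 < \<alpha>"
    show "is_pos_root (\<lambda>k. robin_det l \<mu> R k \<alpha>) p (robin_root l \<mu> R p \<alpha>)" if "1 \<le> p" for p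
      using that robin_root_eq(1)[OF \<mu> R \<alpha>] by (cases p) auto
    show "{k. 0 < k \<and> robin_det l \<mu> R k \<alpha> = 0} = (\<lambda>p. robin_root l \<mu> R p \<alpha>) ` {1..}"
      using robin_det_roots[OF \<mu> R, of \<alpha> 0 l] \<alpha>
      unfolding range_Suc image_image by (simp add: robin_root_eq(2)[OF \<mu> R \<alpha>])
    have "strict_mono (\<lambda>n. robin_root l \<mu> R (Suc n) \<alpha>)"
      using strict_mono_robin_det_roots[OF \<mu> R, of \<alpha> 0 l] \<alpha> by (simp add: robin_root_eq(2)[OF \<mu> R \<alpha>])
    then show "strict_mono_on {1..} (\<lambda>p. robin_root l \<mu> R p \<alpha>)"
      unfolding range_Suc by (auto simp: strict_mono_on_def strict_mono_def)
    show "filterlim (\<lambda>p. robin_root l \<mu> R p \<alpha>) at_top sequentially"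
      by (rule filterlim_robin_root[OF \<mu> R \<alpha>])
    fix p :: nat assume "1 \<le> p"
    then obtain n where p: "p = Suc n" using Suc by blast
    note facts = robin_root_facts[OF \<mu> R \<alpha>, of l n, folded p]
    show "\<exists>u. radial_eigenfunction d l R \<alpha> ((robin_root l \<mu> R p \<alpha>)\<^sup>2) u"
      using radial_eigenfunction_radial_bessel(1)[OF \<mu> R d facts(3,4)] by blast
    show "\<exists>c. \<forall>r\<in>{0<..R}. v r = c * u r"
      if "radial_eigenfunction d l R \<alpha> ((robin_root l \<mu> R p \<alpha>)\<^sup>2) u"
        "radial_eigenfunction d l R \<alpha> ((robin_root l \<mu> R p \<alpha>)\<^sup>2) v" for u v
      by (rule radial_eigenfunction_unique[OF \<mu> R facts(1) d facts(3,4) that])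
    show "neumann_root l \<mu> p / R < robin_root l \<mu> R p \<alpha>"
      unfolding p by (rule neumann_root_less_robin_root[OF \<mu> R \<alpha>])
    show "robin_root l \<mu> R p \<alpha> < dirichlet_root \<mu> p / R"
      unfolding p by (rule robin_root_less_dirichlet_root[OF \<mu> R \<alpha>])
  next
    show "real_analytic2_on (\<lambda>(k, \<alpha>). robin_det l \<mu> R k \<alpha>) ({0<..} \<times> {0<..})"
      by (rule real_analytic2_on_robin_det[OF \<mu> R])
    fix p :: nat assume "1 \<le> p"
    then obtain n where p: "p = Suc n" using Suc by blast
    show "real_analytic_on (\<lambda>\<alpha>. robin_root l \<mu> R p \<alpha>) {0<..}"
      unfolding p by (rule real_analytic_on_robin_root[OF \<mu> R])
    show "strict_mono_on {0<..} (\<lambda>\<alpha>. robin_root l \<mu> R p \<alpha>)"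
      unfolding p by (auto simp: strict_mono_on_def robin_root_strict_mono[OF \<mu> R])
    show "is_pos_root (neumann_fun l \<mu>) p (pos_root (neumann_fun l \<mu>) p)"
      unfolding p by (rule pos_root_neumann_fun(1)[OF \<mu>])
    show "is_pos_root (bessel_J \<mu>) p (dirichlet_root \<mu> p)"
      unfolding p by (rule dirichlet_root_eq(1)[OF \<mu>])
    show "((\<lambda>\<alpha>. robin_root l \<mu> R p \<alpha>) \<longlongrightarrow> neumann_root l \<mu> p / R) (at_right 0)"
      unfolding p by (rule robin_root_tendsto_neumann_root[OF \<mu> R])
    show "((\<lambda>\<alpha>. robin_root l \<mu> R p \<alpha>) \<longlongrightarrow> dirichlet_root \<mu> p / R) at_top"
      unfolding p by (rule robin_root_tendsto_dirichlet_root[OF \<mu> R])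
  next
    show "neumann_fun l \<mu> x = 0 \<longleftrightarrow> (bessel_J \<mu> has_real_derivative \<nu> / x * bessel_J \<mu> x) (at x)"
      if "0 < x" for x
      using neumann_fun_eq_0_iff[OF \<mu> that assms(3)] .
  qed
qed

end
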